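(* Let $X$ be a finite set of cardinality $n$ and let $(X,S)$ be a non-degenerate symmetric set-theoretical solution of the quantum Yang-Baxter equation, with structure group $G(X,S)$ and associated Garside monoid $M(X,S)$. Let $W(X,S)=\psi(G(X,S))$ and $\mathbf{X}=\{\psi_x\mid x\in X\}$. (1) $W(X,S)$ is a finite quotient of $G(X,S)$, and $(W(X,S),\mathbf{X})$ is a generating generated group for $M(X,S)$. (2) If $(X,S)$ verifies Property $(\mathcal{C})$, then $(W(X,S),\mathbf{X})$ is a generating generated section for $M(X,S)$. Moreover, in this case the order of $W(X,S)$ is $2^n$ and there is an exact sequence $$1\to N(X,S)\to G(X,S)\xrightarrow{\ \psi\ } W(X,S)\to 1$$ where $N(X,S)=\ker(\psi)$ is a free Abelian group of rank $n$.
   Context: Solutions and structure groups. Let $X$ be a finite set and $S:X\times X\to X\times X$ a bijection; write $S(x,y)=(g_x(y),f_y(x))$ with $g_x,f_y:X\to X$. $(X,S)$ is non-degenerate if all $f_x,g_x$ are bijections; it is symmetric if it is involutive ($S\circ S=\mathrm{Id}$) and braided ($S^{12}S^{23}S^{12}=S^{23}S^{12}S^{23}$ on $X^3$, where $S^{i,i+1}$ is $S$ acting on components $i,i+1$). The monoid $M(X,S)$ is given by the monoid presentation $\langle X\mid xy=g_x(y)f_y(x);\ x,y\in X,\ S(x,y)\ne(x,y)\rangle$, and the structure group $G(X,S)$ is the group with the same presentation. (It is known that $M(X,S)$ is a Garside monoid with atom set $X$, and that it embeds in $G(X,S)$, its group of fractions.) Frozen pairs and Property $(\mathcal{C})$.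 A pair $(x,y)\in X\times X$ is frozen if $S(x,y)=(x,y)$. $(X,S)$ (equivalently $M(X,S)$) verifies Property $(\mathcal{C})$ if for every frozen pair $(x,y)$ one has $g_x\circ g_y=\mathrm{Id}_X$ and $f_y\circ f_x=\mathrm{Id}_X$. The map $\psi$. Let $V$ be the real vector space with basis $X$ and let $\phi_x=f_x^{-1}$. For $x\in X$, let $\psi_x\in GL(V)$ be the linear map with $\psi_x(y)=\phi_x(y)$ for $y\in X$, $y\ne x$, and $\psi_x(x)=-\phi_x(x)$. The map $x\mapsto\psi_x$ extends to a group morphism $\psi:G(X,S)\to GL(V)$. Generating generated groups. Let $W$ be a finite group with a generating set $Y$. For $v\in W$, $\ell_Y(v)$ is the minimal length of a (positive) word on $Y$ representing $v$. If $w_1=w_2w_3$ with $\ell_Y(w_1)=\ell_Y(w_2)+\ell_Y(w_3)$, then $w_2$ is a left $Y$-factor and $w_3$ a right $Y$-factor of $w_1$. An element $w$ is $Y$-balanced if its sets of left $Y$-factors and of right $Y$-factors coincide; this set is then denoted $D_Y(w)$. For $w$ $Y$-balanced, $M_{w,Y}$ is the monoid with generators $\underline{v}$, $v\in D_Y(w)$, and relations $\underline{v}\,\underline{v'}=\underline{v''}$ whenever $v,v',v''\in D_Y(w)$, $vv'=v''$ and $\ell_Y(v)+\ell_Y(v')=\ell_Y(v'')$, with the convention that $\underline{1}$ is the identity. $(W,Y)$ is a generating generated group for a monoid $M$ if $W$ contains a $Y$-balanced element $w$ such that $D_Y(w)$ generates $W$ and $M$ is isomorphic to $M_{w,Y}$;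 it is a generating generated section for $M$ if moreover $D_Y(w)=W$. *)

theory Defs
  imports Complex_Main "HOL-Algebra.Bij" "HOL-Algebra.Generated_Groups" "HOL-Algebra.Free_Abelian_Groups"
begin

section \<open>Presentations of monoids and groups\<close>

inductive_set mon_cong :: "'g set \<Rightarrow> ('g list \<times> 'g list) set \<Rightarrow> ('g list \<times> 'g list) set"
  for A :: "'g set" and R :: "('g list \<times> 'g list) set"
where
  rel: "\<lbrakk>(u, v) \<in> R; u \<in> lists A; v \<in> lists A\<rbrakk> \<Longrightarrow> (u, v) \<in> mon_cong A R"
| refl: "u \<in> lists A \<Longrightarrow> (u, u) \<in> mon_cong A R"
| sym: "(u, v) \<in> mon_cong A R \<Longrightarrow> (v, u) \<in> mon_cong A R"
| trans: "\<lbrakk>(u, v) \<in> mon_cong A R; (v, w) \<in> mon_cong A R\<rbrakk> \<Longrightarrow> (u, w) \<in> mon_cong A R"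
| app: "\<lbrakk>(u, v) \<in> mon_cong A R; (u', v') \<in> mon_cong A R\<rbrakk> \<Longrightarrow> (u @ u', v @ v') \<in> mon_cong A R"

definition mon_pres :: "'g set \<Rightarrow> ('g list \<times> 'g list) set \<Rightarrow> 'g list set monoid" where
  "mon_pres A R =
    \<lparr>carrier = lists A // mon_cong A R,
     monoid.mult = (\<lambda>c d. \<Union>u\<in>c. \<Union>v\<in>d. mon_cong A R `` {u @ v}),
     one = mon_cong A R `` {[]}\<rparr>"

text \<open>The group presented by generators \<open>A\<close> and relations \<open>R\<close> between positive words,
  realised as a monoid on letters \<open>(a, True)\<close>, standing for the generator \<open>a\<close>, and
  \<open>(a, False)\<close>, standing for its formal inverse.\<close>

definition signed_rels :: "'g set \<Rightarrow> ('g list \<times> 'g list) set \<Rightarrow> (('g \<times> bool) list \<times> ('g \<times> bool) list) set" where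
  "signed_rels A R =
     (\<lambda>(u, v). (map (\<lambda>a. (a, True)) u, map (\<lambda>a. (a, True)) v)) ` R
     \<union> {([(a, b), (a, \<not> b)], []) | a b. a \<in> A}"

definition grp_pres :: "'g set \<Rightarrow> ('g list \<times> 'g list) set \<Rightarrow> ('g \<times> bool) list set monoid" where
  "grp_pres A R = mon_pres (A \<times> UNIV) (signed_rels A R)"

definition grp_gen :: "'g set \<Rightarrow> ('g list \<times> 'g list) set \<Rightarrow> 'g \<Rightarrow> ('g \<times> bool) list set" where
  "grp_gen A R a = mon_cong (A \<times> UNIV) (signed_rels A R) `` {[(a, True)]}"

definition signed_eval :: "('h, 'm) monoid_scheme \<Rightarrow> ('g \<Rightarrow> 'h) \<Rightarrow> ('g \<times> bool) list \<Rightarrow> 'h" where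
  "signed_eval H p w =
     foldr (\<lambda>(a, b) h. (if b then p a else inv\<^bsub>H\<^esub> (p a)) \<otimes>\<^bsub>H\<^esub> h) w \<one>\<^bsub>H\<^esub>"


section \<open>Set-theoretical solutions\<close>

definition sol_g :: "('a \<times> 'a \<Rightarrow> 'a \<times> 'a) \<Rightarrow> 'a \<Rightarrow> 'a \<Rightarrow> 'a" where
  "sol_g S x y = fst (S (x, y))"

definition sol_f :: "('a \<times> 'a \<Rightarrow> 'a \<times> 'a) \<Rightarrow> 'a \<Rightarrow> 'a \<Rightarrow> 'a" where
  "sol_f S y x = snd (S (x, y))"

definition nondegenerate :: "'a set \<Rightarrow> ('a \<times> 'a \<Rightarrow> 'a \<times> 'a) \<Rightarrow> bool" where
  "nondegenerate X S \<longleftrightarrow> (\<forall>x\<in>X. bij_betw (sol_f S x) X X \<and> bij_betw (sol_g S x) X X)"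

definition involutive :: "'a set \<Rightarrow> ('a \<times> 'a \<Rightarrow> 'a \<times> 'a) \<Rightarrow> bool" where
  "involutive X S \<longleftrightarrow> (\<forall>p\<in>X \<times> X. S (S p) = p)"

definition act12 :: "('a \<times> 'a \<Rightarrow> 'a \<times> 'a) \<Rightarrow> 'a \<times> 'a \<times> 'a \<Rightarrow> 'a \<times> 'a \<times> 'a" where
  "act12 S = (\<lambda>(x, y, z). let (x', y') = S (x, y) in (x', y', z))"

definition act23 :: "('a \<times> 'a \<Rightarrow> 'a \<times> 'a) \<Rightarrow> 'a \<times> 'a \<times> 'a \<Rightarrow> 'a \<times> 'a \<times> 'a" where
  "act23 S = (\<lambda>(x, y, z). let (y', z') = S (y, z) in (x, y', z'))"

definition braided :: "'a set \<Rightarrow> ('a \<times> 'a \<Rightarrow> 'a \<times> 'a) \<Rightarrow> bool" where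
  "braided X S \<longleftrightarrow>
     (\<forall>t\<in>X \<times> X \<times> X. act12 S (act23 S (act12 S t)) = act23 S (act12 S (act23 S t)))"

text \<open>If \<open>S\<close> is a map \<open>R\<close> followed by the flip, then \<open>S\<close> is braided iff \<open>R\<close> solves the
  quantum Yang-Baxter equation.\<close>

definition symmetric_sol :: "'a set \<Rightarrow> ('a \<times> 'a \<Rightarrow> 'a \<times> 'a) \<Rightarrow> bool" where
  "symmetric_sol X S \<longleftrightarrow>
     bij_betw S (X \<times> X) (X \<times> X) \<and> involutive X S \<and> braided X S"

definition frozen :: "('a \<times> 'a \<Rightarrow> 'a \<times> 'a) \<Rightarrow> 'a \<Rightarrow> 'a \<Rightarrow> bool" where
  "frozen S x y \<longleftrightarrow> S (x, y) = (x, y)"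

definition property_C :: "'a set \<Rightarrow> ('a \<times> 'a \<Rightarrow> 'a \<times> 'a) \<Rightarrow> bool" where
  "property_C X S \<longleftrightarrow>
     (\<forall>x\<in>X. \<forall>y\<in>X. frozen S x y \<longrightarrow>
        (\<forall>z\<in>X. sol_g S x (sol_g S y z) = z) \<and> (\<forall>z\<in>X. sol_f S y (sol_f S x z) = z))"

definition sol_rels :: "'a set \<Rightarrow> ('a \<times> 'a \<Rightarrow> 'a \<times> 'a) \<Rightarrow> ('a list \<times> 'a list) set" where
  "sol_rels X S =
     {([x, y], [sol_g S x y, sol_f S y x]) | x y. x \<in> X \<and> y \<in> X \<and> S (x, y) \<noteq> (x, y)}"

definition struct_monoid :: "'a set \<Rightarrow> ('a \<times> 'a \<Rightarrow> 'a \<times> 'a) \<Rightarrow> 'a list set monoid" where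
  "struct_monoid X S = mon_pres X (sol_rels X S)"

definition struct_group :: "'a set \<Rightarrow> ('a \<times> 'a \<Rightarrow> 'a \<times> 'a) \<Rightarrow> ('a \<times> bool) list set monoid" where
  "struct_group X S = grp_pres X (sol_rels X S)"

definition struct_gen :: "'a set \<Rightarrow> ('a \<times> 'a \<Rightarrow> 'a \<times> 'a) \<Rightarrow> 'a \<Rightarrow> ('a \<times> bool) list set" where
  "struct_gen X S x = grp_gen X (sol_rels X S) x"


section \<open>The linear representation\<close>

text \<open>The real vector space with basis a finite set \<open>X\<close>: real functions vanishing outside \<open>X\<close>,
  with pointwise operations.\<close>

definition vsp :: "'a set \<Rightarrow> ('a \<Rightarrow> real) set" where
  "vsp X = {v. \<forall>a. a \<notin> X \<longrightarrow> v a = 0}"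

definition basis_vec :: "'a \<Rightarrow> 'a \<Rightarrow> real" where
  "basis_vec y = (\<lambda>z. if z = y then 1 else 0)"

definition GL :: "'a set \<Rightarrow> (('a \<Rightarrow> real) \<Rightarrow> ('a \<Rightarrow> real)) monoid" where
  "GL X = (BijGroup (vsp X))
     \<lparr>carrier := {h \<in> Bij (vsp X).
        (\<forall>u\<in>vsp X. \<forall>v\<in>vsp X. h (\<lambda>a. u a + v a) = (\<lambda>a. h u a + h v a)) \<and>
        (\<forall>c. \<forall>v\<in>vsp X. h (\<lambda>a. c * v a) = (\<lambda>a. c * h v a))}\<rparr>"

text \<open>The linear map on \<open>vsp X\<close> with prescribed values on the basis vectors.\<close>

definition lin_ext :: "'a set \<Rightarrow> ('a \<Rightarrow> 'a \<Rightarrow> real) \<Rightarrow> ('a \<Rightarrow> real) \<Rightarrow> ('a \<Rightarrow> real)" where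
  "lin_ext X b = (\<lambda>v\<in>vsp X. \<lambda>z. \<Sum>y\<in>X. v y * b y z)"

definition sol_phi :: "'a set \<Rightarrow> ('a \<times> 'a \<Rightarrow> 'a \<times> 'a) \<Rightarrow> 'a \<Rightarrow> 'a \<Rightarrow> 'a" where
  "sol_phi X S x = inv_into X (sol_f S x)"

definition psi_gen :: "'a set \<Rightarrow> ('a \<times> 'a \<Rightarrow> 'a \<times> 'a) \<Rightarrow> 'a \<Rightarrow> ('a \<Rightarrow> real) \<Rightarrow> ('a \<Rightarrow> real)" where
  "psi_gen X S x =
     lin_ext X (\<lambda>y z. if y = x then - basis_vec (sol_phi X S x y) z
                      else basis_vec (sol_phi X S x y) z)"

text \<open>An element of the structure group is a class of signed words; it is sent to the common
  value of these words.\<close>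

definition psi :: "'a set \<Rightarrow> ('a \<times> 'a \<Rightarrow> 'a \<times> 'a) \<Rightarrow>
    ('a \<times> bool) list set \<Rightarrow> (('a \<Rightarrow> real) \<Rightarrow> ('a \<Rightarrow> real))" where
  "psi X S c = the_elem (signed_eval (GL X) (psi_gen X S) ` c)"

definition W_group :: "'a set \<Rightarrow> ('a \<times> 'a \<Rightarrow> 'a \<times> 'a) \<Rightarrow>
    (('a \<Rightarrow> real) \<Rightarrow> ('a \<Rightarrow> real)) monoid" where
  "W_group X S = (GL X)\<lparr>carrier := psi X S ` carrier (struct_group X S)\<rparr>"

definition N_group :: "'a set \<Rightarrow> ('a \<times> 'a \<Rightarrow> 'a \<times> 'a) \<Rightarrow> ('a \<times> bool) list set monoid" where
  "N_group X S = (struct_group X S)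
     \<lparr>carrier := kernel (struct_group X S) (W_group X S) (psi X S)\<rparr>"


section \<open>Generating generated groups\<close>

text \<open>Only meaningful for elements that are products of elements of \<open>Y\<close>; when \<open>Y\<close> generates a
  finite group this is every element.\<close>

definition ell :: "('w, 'm) monoid_scheme \<Rightarrow> 'w set \<Rightarrow> 'w \<Rightarrow> nat" where
  "ell W Y v = (LEAST k. \<exists>ws\<in>lists Y. length ws = k \<and> foldr (\<otimes>\<^bsub>W\<^esub>) ws \<one>\<^bsub>W\<^esub> = v)"

definition left_factors :: "('w, 'm) monoid_scheme \<Rightarrow> 'w set \<Rightarrow> 'w \<Rightarrow> 'w set" where
  "left_factors W Y w =
     {u \<in> carrier W. \<exists>v\<in>carrier W. w = u \<otimes>\<^bsub>W\<^esub> v \<and> ell W Y w = ell W Y u + ell W Y v}"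

definition right_factors :: "('w, 'm) monoid_scheme \<Rightarrow> 'w set \<Rightarrow> 'w \<Rightarrow> 'w set" where
  "right_factors W Y w =
     {v \<in> carrier W. \<exists>u\<in>carrier W. w = u \<otimes>\<^bsub>W\<^esub> v \<and> ell W Y w = ell W Y u + ell W Y v}"

definition balanced :: "('w, 'm) monoid_scheme \<Rightarrow> 'w set \<Rightarrow> 'w \<Rightarrow> bool" where
  "balanced W Y w \<longleftrightarrow> w \<in> carrier W \<and> left_factors W Y w = right_factors W Y w"

text \<open>Used only for balanced \<open>w\<close>.\<close>

definition D_factors :: "('w, 'm) monoid_scheme \<Rightarrow> 'w set \<Rightarrow> 'w \<Rightarrow> 'w set" where
  "D_factors W Y w = left_factors W Y w"

definition factor_monoid :: "('w, 'm) monoid_scheme \<Rightarrow> 'w set \<Rightarrow> 'w \<Rightarrow> 'w list set monoid" where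
  "factor_monoid W Y w = mon_pres (D_factors W Y w)
     ({([v, v'], [v'']) | v v' v''.
         v \<in> D_factors W Y w \<and> v' \<in> D_factors W Y w \<and> v'' \<in> D_factors W Y w \<and>
         v \<otimes>\<^bsub>W\<^esub> v' = v'' \<and> ell W Y v + ell W Y v' = ell W Y v''}
      \<union> {([\<one>\<^bsub>W\<^esub>], [])})"

definition fin_gen_group :: "('w, 'm) monoid_scheme \<Rightarrow> 'w set \<Rightarrow> bool" where
  "fin_gen_group W Y \<longleftrightarrow>
     group W \<and> finite (carrier W) \<and> Y \<subseteq> carrier W \<and> generate W Y = carrier W"

definition generating_generated_group ::
    "('w, 'm) monoid_scheme \<Rightarrow> 'w set \<Rightarrow> ('k, 'l) monoid_scheme \<Rightarrow> bool" where
  "generating_generated_group W Y M \<longleftrightarrow> fin_gen_group W Y \<and>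
     (\<exists>w. balanced W Y w \<and> generate W (D_factors W Y w) = carrier W \<and> M \<cong> factor_monoid W Y w)"

definition generating_generated_section ::
    "('w, 'm) monoid_scheme \<Rightarrow> 'w set \<Rightarrow> ('k, 'l) monoid_scheme \<Rightarrow> bool" where
  "generating_generated_section W Y M \<longleftrightarrow> fin_gen_group W Y \<and>
     (\<exists>w. balanced W Y w \<and> generate W (D_factors W Y w) = carrier W \<and> M \<cong> factor_monoid W Y w \<and>
          D_factors W Y w = carrier W)"


section \<open>Short exact sequences\<close>

text \<open>The library's \<open>exact_seq\<close> requires all groups of the sequence to have the same type.\<close>

definition short_exact ::
    "('n, 'p) monoid_scheme \<Rightarrow> ('n \<Rightarrow> 'g) \<Rightarrow> ('g, 'q) monoid_scheme \<Rightarrow> ('g \<Rightarrow> 'w) \<Rightarrow>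
     ('w, 'r) monoid_scheme \<Rightarrow> bool" where
  "short_exact N i G p W \<longleftrightarrow> group N \<and> group G \<and> group W \<and>
     i \<in> mon N G \<and> i ` carrier N = kernel G W p \<and> p \<in> epi G W"

end

theory Submission
  imports Defs "HOL-Library.Multiset" "HOL-Algebra.Multiplicative_Group"
begin

text \<open>
  Let \<open>f\<close> act on \<open>X\<close> from the right by words, and give a word \<open>w = x\<^sub>1 \<dots> x\<^sub>k\<close> the multiset \<open>wms w\<close>
  of the images of the \<open>x\<^sub>i\<close> under the action of the letters behind them. Two positive words are
  equal in the structure monoid iff they have the same multiset: a defining relation can move any
  prescribed element of \<open>wms w\<close> to the first letter, and one inducts on the length. The signed
  permutation \<open>\<psi>\<^sub>w\<close> has its signs on the elements of odd multiplicity in \<open>wms w\<close>. Hence a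
  word whose multiset is squarefree is determined in the monoid by its image in \<open>W\<close>, and these are
  exactly the words that are shortest possible for their sign pattern; the factors of the
  image of the word \<open>\<Delta>\<close> with multiset \<open>X\<close> are the images of the squarefree words.

  Under Property (C) the word \<open>\<phi>\<^sub>x(x) x\<close> acts trivially and has multiset \<open>{x, x}\<close>. So every
  element of \<open>W\<close> is the image of a squarefree word, and the kernel of \<open>\<psi>\<close> consists of the elements with
  trivial action and even multiplicities; halving these identifies it with \<open>\<int>\<^sup>n\<close>.
\<close>

section \<open>Presentations\<close>

text \<open>Keeps \<open>auto\<close> and \<open>blast\<close> from unfolding membership in
  \<open>lists A\<close> into a statement on single letters, so that lemmas on words still
  apply.\<close>

declare in_listsD [rule del] in_listsI [rule del]

lemma mon_cong_in_lists: "(u, v) \<in> mon_cong A R \<Longrightarrow> u \<in> lists A \<and> v \<in> lists A"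
  by (induction rule: mon_cong.induct) auto

lemma equiv_mon_cong: "equiv (lists A) (mon_cong A R)"
proof (rule equivI)
  show "mon_cong A R \<subseteq> lists A \<times> lists A"
    using mon_cong_in_lists by (metis mem_Sigma_iff subrelI)
  show "refl_on (lists A) (mon_cong A R)"
    by (simp add: refl_on_def mon_cong.refl)
  show "sym (mon_cong A R)"
    by (meson symI mon_cong.sym)
  show "trans (mon_cong A R)"
    by (meson transI mon_cong.trans)
qed

abbreviation word_class :: "'g set \<Rightarrow> ('g list \<times> 'g list) set \<Rightarrow> 'g list \<Rightarrow> 'g list set" where
  "word_class A R u \<equiv> mon_cong A R `` {u}"

lemma word_class_eq_iff:
  "u \<in> lists A \<Longrightarrow> v \<in> lists A \<Longrightarrow> word_class A R u = word_class A R v \<longleftrightarrow> (u, v) \<in> mon_cong A R"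
  using eq_equiv_class_iff[OF equiv_mon_cong, of u A v R] by blast

lemma in_word_class: "u \<in> lists A \<Longrightarrow> u \<in> word_class A R u"
  by (simp add: mon_cong.refl)

lemma carrier_mon_pres: "carrier (mon_pres A R) = word_class A R ` lists A"
  by (auto simp: mon_pres_def quotient_def)

lemma mon_pres_carrierE:
  assumes "c \<in> carrier (mon_pres A R)"
  obtains u where "u \<in> lists A" "c = word_class A R u"
  using assms unfolding carrier_mon_pres by (rule imageE)

lemma one_mon_pres: "\<one>\<^bsub>mon_pres A R\<^esub> = word_class A R []"
  by (simp add: mon_pres_def)

text \<open>All concatenations of representatives lie in one class by \<open>mon_cong.app\<close>,
  and both classes are nonempty. So the double union that encodes the product collapses.\<close>

lemma mult_mon_pres:
  assumes "u \<in> lists A" "v \<in> lists A"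
  shows "word_class A R u \<otimes>\<^bsub>mon_pres A R\<^esub> word_class A R v = word_class A R (u @ v)"
proof -
  have "word_class A R (u' @ v') = word_class A R (u @ v)"
    if "(u, u') \<in> mon_cong A R" "(v, v') \<in> mon_cong A R" for u' v'
    using equiv_class_eq[OF equiv_mon_cong mon_cong.app[OF that]] by (rule HOL.sym)
  then have "(\<Union>u'\<in>word_class A R u. \<Union>v'\<in>word_class A R v. word_class A R (u' @ v'))
      = (\<Union>u'\<in>word_class A R u. \<Union>v'\<in>word_class A R v. word_class A R (u @ v))"
    by (intro SUP_cong HOL.refl) (simp only: Image_singleton_iff)
  also have "\<dots> = word_class A R (u @ v)"
    using in_word_class[OF assms(1), of R] in_word_class[OF assms(2), of R]
    by (metis UN_constant empty_iff)
  finally show ?thesis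
    unfolding mon_pres_def monoid.simps .
qed

lemma mon_cong_append_left:
  "(v, v') \<in> mon_cong A R \<Longrightarrow> u \<in> lists A \<Longrightarrow> (u @ v, u @ v') \<in> mon_cong A R"
  by (rule mon_cong.app[OF mon_cong.refl])

lemma mon_cong_append_right:
  "(v, v') \<in> mon_cong A R \<Longrightarrow> u \<in> lists A \<Longrightarrow> (v @ u, v' @ u) \<in> mon_cong A R"
  by (rule mon_cong.app[OF _ mon_cong.refl])

lemma mon_cong_Cons:
  "(v, v') \<in> mon_cong A R \<Longrightarrow> x \<in> A \<Longrightarrow> (x # v, x # v') \<in> mon_cong A R"
  using mon_cong_append_left[of v v' A R "[x]"] by simp

lemma mon_cong_concat_map:
  assumes "(u, v) \<in> mon_cong A R"
    and "\<And>a. a \<in> A \<Longrightarrow> h a \<in> lists B"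
    and "\<And>u v. (u, v) \<in> R \<Longrightarrow> u \<in> lists A \<Longrightarrow> v \<in> lists A \<Longrightarrow>
      (concat (map h u), concat (map h v)) \<in> mon_cong B Q"
  shows "(concat (map h u), concat (map h v)) \<in> mon_cong B Q"
  using assms(1)
proof (induction rule: mon_cong.induct)
  case (refl u)
  then have "concat (map h u) \<in> lists B"
    using assms(2) by (induction u) auto
  then show ?case by (rule mon_cong.refl)
qed (auto intro: assms(3) mon_cong.sym mon_cong.trans mon_cong.app)

text \<open>Substitutions of words for generators induce an isomorphism once both respect the
  defining relations and are mutually inverse on generators. This is how the structure monoid is
  later compared with the monoid of factors.\<close>

lemma mon_pres_iso:
  assumes h: "\<And>a. a \<in> A \<Longrightarrow> h a \<in> lists B"
    and k: "\<And>b. b \<in> B \<Longrightarrow> k b \<in> lists A"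
    and hR: "\<And>u v. (u, v) \<in> R \<Longrightarrow> u \<in> lists A \<Longrightarrow> v \<in> lists A \<Longrightarrow>
      (concat (map h u), concat (map h v)) \<in> mon_cong B Q"
    and kQ: "\<And>u v. (u, v) \<in> Q \<Longrightarrow> u \<in> lists B \<Longrightarrow> v \<in> lists B \<Longrightarrow>
      (concat (map k u), concat (map k v)) \<in> mon_cong A R"
    and kh: "\<And>a. a \<in> A \<Longrightarrow> (concat (map k (h a)), [a]) \<in> mon_cong A R"
    and hk: "\<And>b. b \<in> B \<Longrightarrow> (concat (map h (k b)), [b]) \<in> mon_cong B Q"
  shows "mon_pres A R \<cong> mon_pres B Q"
proof -
  let ?h = "\<lambda>u. concat (map h u)" and ?k = "\<lambda>u. concat (map k u)"
  have hl: "?h u \<in> lists B" if "u \<in> lists A" for u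
    using that h by (induction u) auto
  have kl: "?k u \<in> lists A" if "u \<in> lists B" for u
    using that k by (induction u) auto
  have kh': "(?k (?h u), u) \<in> mon_cong A R" if "u \<in> lists A" for u
    using that
  proof (induction u)
    case (Cons a u)
    then show ?case
      using mon_cong.app[OF kh Cons.IH, of a] by simp
  qed (simp add: mon_cong.refl)
  have hk': "(?h (?k u), u) \<in> mon_cong B Q" if "u \<in> lists B" for u
    using that
  proof (induction u)
    case (Cons a u)
    then show ?case
      using mon_cong.app[OF hk Cons.IH, of a] by simp
  qed (simp add: mon_cong.refl)
  have hc: "(?h u, ?h v) \<in> mon_cong B Q" if "(u, v) \<in> mon_cong A R" for u v
    by (rule mon_cong_concat_map[OF that h hR])
  have kc: "(?k u, ?k v) \<in> mon_cong A R" if "(u, v) \<in> mon_cong B Q" for u v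
    by (rule mon_cong_concat_map[OF that k kQ])
  \<comment> \<open>The union over all representatives avoids a choice: by \<open>hc\<close> every
    member of a class contributes the same class.\<close>
  define F where "F c = (\<Union>u\<in>c. word_class B Q (?h u))" for c
  have F: "F (word_class A R u) = word_class B Q (?h u)" if u: "u \<in> lists A" for u
  proof -
    have "word_class B Q (?h v) = word_class B Q (?h u)" if "v \<in> word_class A R u" for v
      using hc[of u v] that equiv_class_eq[OF equiv_mon_cong] by (metis Image_singleton_iff)
    then have "F (word_class A R u) = (\<Union>v\<in>word_class A R u. word_class B Q (?h u))"
      unfolding F_def by (intro SUP_cong HOL.refl)
    also have "\<dots> = word_class B Q (?h u)"
      using in_word_class[OF u, of R] by (metis UN_constant empty_iff)
    finally show ?thesis .
  qed
  have "F \<in> hom (mon_pres A R) (mon_pres B Q)"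
    by (auto simp: hom_def carrier_mon_pres F hl mult_mon_pres)
  moreover have "inj_on F (carrier (mon_pres A R))"
  proof (rule inj_onI)
    fix c d
    assume "c \<in> carrier (mon_pres A R)" "d \<in> carrier (mon_pres A R)" and eq: "F c = F d"
    then obtain u v where u: "u \<in> lists A" "c = word_class A R u"
      and v: "v \<in> lists A" "d = word_class A R v"
      by (elim mon_pres_carrierE)
    have "(?h u, ?h v) \<in> mon_cong B Q"
      using eq u v by (simp add: F hl word_class_eq_iff)
    then have "(u, v) \<in> mon_cong A R"
      using kc kh' u(1) v(1) by (meson mon_cong.sym mon_cong.trans)
    then show "c = d"
      using u v by (simp add: word_class_eq_iff)
  qed
  moreover have "F ` carrier (mon_pres A R) = carrier (mon_pres B Q)"
  proof
    show "carrier (mon_pres B Q) \<subseteq> F ` carrier (mon_pres A R)"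
    proof
      fix d assume "d \<in> carrier (mon_pres B Q)"
      then obtain u where u: "u \<in> lists B" "d = word_class B Q u"
        by (rule mon_pres_carrierE)
      then have "d = F (word_class A R (?k u))"
        using hk' by (simp add: F kl hl word_class_eq_iff mon_cong.sym)
      then show "d \<in> F ` carrier (mon_pres A R)"
        using kl u by (auto simp: carrier_mon_pres)
    qed
  qed (auto simp: carrier_mon_pres F hl)
  ultimately have "F \<in> iso (mon_pres A R) (mon_pres B Q)"
    by (simp add: iso_def bij_betw_def)
  then show ?thesis
    by (rule is_isoI)
qed

section \<open>Formal inverses and the presented group\<close>

definition word_inv :: "('g \<times> bool) list \<Rightarrow> ('g \<times> bool) list" where
  "word_inv w = rev (map (\<lambda>(a, b). (a, \<not> b)) w)"

lemma word_inv_in_lists: "w \<in> lists (A \<times> UNIV) \<Longrightarrow> word_inv w \<in> lists (A \<times> UNIV)"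
  by (induction w) (auto simp: word_inv_def)

lemma word_inv_word_inv: "word_inv (word_inv w) = w"
  by (induction w) (auto simp: word_inv_def rev_map)

lemma mon_cong_append_word_inv:
  assumes "w \<in> lists (A \<times> UNIV)"
  shows "(w @ word_inv w, []) \<in> mon_cong (A \<times> UNIV) (signed_rels A R)"
  using assms
proof (induction w)
  case (Cons c w)
  obtain a b where c: "c = (a, b)" "a \<in> A"
    using Cons by (cases c) auto
  have "([c] @ (w @ word_inv w) @ [(a, \<not> b)], [c] @ [] @ [(a, \<not> b)])
      \<in> mon_cong (A \<times> UNIV) (signed_rels A R)"
    using Cons c by (intro mon_cong.app mon_cong.refl) auto
  moreover have "([c] @ [] @ [(a, \<not> b)], []) \<in> mon_cong (A \<times> UNIV) (signed_rels A R)"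
    using c by (intro mon_cong.rel) (auto simp: signed_rels_def)
  ultimately show ?case
    using c by (auto simp: word_inv_def intro: mon_cong.trans)
qed (simp add: word_inv_def mon_cong.refl)

lemma mon_cong_word_inv_append:
  "w \<in> lists (A \<times> UNIV) \<Longrightarrow> (word_inv w @ w, []) \<in> mon_cong (A \<times> UNIV) (signed_rels A R)"
  using mon_cong_append_word_inv[OF word_inv_in_lists] by (metis word_inv_word_inv)

lemma mon_cong_signed_cancel_left:
  assumes "(w @ u, w @ v) \<in> mon_cong (A \<times> UNIV) (signed_rels A R)"
  shows "(u, v) \<in> mon_cong (A \<times> UNIV) (signed_rels A R)"
proof -
  have w: "w \<in> lists (A \<times> UNIV)" and u: "u \<in> lists (A \<times> UNIV)" and v: "v \<in> lists (A \<times> UNIV)"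
    using mon_cong_in_lists[OF assms] by auto
  have *: "((word_inv w @ w) @ z, [] @ z) \<in> mon_cong (A \<times> UNIV) (signed_rels A R)"
    if "z \<in> lists (A \<times> UNIV)" for z
    by (rule mon_cong.app[OF mon_cong_word_inv_append[OF w] mon_cong.refl[OF that]])
  have "(word_inv w @ w @ u, word_inv w @ w @ v) \<in> mon_cong (A \<times> UNIV) (signed_rels A R)"
    using assms by (rule mon_cong_append_left) (rule word_inv_in_lists[OF w])
  then show ?thesis
    using *[OF u] *[OF v] by (auto intro: mon_cong.sym mon_cong.trans)
qed

lemma monoid_mon_pres: "monoid (mon_pres A R)"
proof (rule monoidI)
  fix c d assume "c \<in> carrier (mon_pres A R)" "d \<in> carrier (mon_pres A R)"
  then obtain u v where u: "u \<in> lists A" "c = word_class A R u"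
    and v: "v \<in> lists A" "d = word_class A R v"
    by (elim mon_pres_carrierE)
  have "word_class A R (u @ v) \<in> word_class A R ` lists A"
    using u(1) v(1) by (rule imageI[OF iffD2[OF append_in_lists_conv conjI]])
  then show "c \<otimes>\<^bsub>mon_pres A R\<^esub> d \<in> carrier (mon_pres A R)"
    unfolding u(2) v(2) carrier_mon_pres mult_mon_pres[OF u(1) v(1)] .
next
  show "\<one>\<^bsub>mon_pres A R\<^esub> \<in> carrier (mon_pres A R)"
    unfolding one_mon_pres carrier_mon_pres by (rule imageI[OF lists.Nil])
next
  fix c d e
  assume "c \<in> carrier (mon_pres A R)" "d \<in> carrier (mon_pres A R)" "e \<in> carrier (mon_pres A R)"
  then obtain u v w where u: "u \<in> lists A" "c = word_class A R u"
    and v: "v \<in> lists A" "d = word_class A R v" and w: "w \<in> lists A" "e = word_class A R w"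
    by (elim mon_pres_carrierE)
  have uv: "u @ v \<in> lists A" and vw: "v @ w \<in> lists A"
    using u(1) v(1) w(1) by simp_all
  show "c \<otimes>\<^bsub>mon_pres A R\<^esub> d \<otimes>\<^bsub>mon_pres A R\<^esub> e = c \<otimes>\<^bsub>mon_pres A R\<^esub> (d \<otimes>\<^bsub>mon_pres A R\<^esub> e)"
    unfolding u(2) v(2) w(2) mult_mon_pres[OF u(1) v(1)] mult_mon_pres[OF uv w(1)]
      mult_mon_pres[OF v(1) w(1)] mult_mon_pres[OF u(1) vw] append_assoc ..
next
  fix c assume "c \<in> carrier (mon_pres A R)"
  then obtain u where u: "u \<in> lists A" "c = word_class A R u"
    by (rule mon_pres_carrierE)
  show "\<one>\<^bsub>mon_pres A R\<^esub> \<otimes>\<^bsub>mon_pres A R\<^esub> c = c" "c \<otimes>\<^bsub>mon_pres A R\<^esub> \<one>\<^bsub>mon_pres A R\<^esub> = c"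
    unfolding u(2) one_mon_pres using mult_mon_pres[OF lists.Nil u(1)] mult_mon_pres[OF u(1) lists.Nil]
    by (simp_all only: append_Nil append_Nil2)
qed

lemma group_grp_pres: "group (grp_pres A R)"
  unfolding grp_pres_def
proof (rule monoid.group_l_invI[OF monoid_mon_pres])
  let ?P = "mon_pres (A \<times> UNIV) (signed_rels A R)"
  fix c assume "c \<in> carrier ?P"
  then obtain w where w: "w \<in> lists (A \<times> UNIV)"
    "c = word_class (A \<times> UNIV) (signed_rels A R) w"
    by (rule mon_pres_carrierE)
  let ?d = "word_class (A \<times> UNIV) (signed_rels A R) (word_inv w)"
  have wi: "word_inv w \<in> lists (A \<times> UNIV)"
    using w(1) by (rule word_inv_in_lists)
  have "?d \<in> carrier ?P"
    unfolding carrier_mon_pres using wi by (rule imageI)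
  moreover have "?d \<otimes>\<^bsub>?P\<^esub> c = \<one>\<^bsub>?P\<^esub>"
    unfolding w(2) mult_mon_pres[OF wi w(1)] one_mon_pres
    using mon_cong_word_inv_append[OF w(1)] by (rule equiv_class_eq[OF equiv_mon_cong])
  ultimately show "\<exists>d\<in>carrier ?P. d \<otimes>\<^bsub>?P\<^esub> c = \<one>\<^bsub>?P\<^esub>" ..
qed

definition pos_word :: "'g list \<Rightarrow> ('g \<times> bool) list" where
  "pos_word = map (\<lambda>a. (a, True))"

lemma pos_word_simps [simp]:
  "pos_word [] = []" "pos_word (a # u) = (a, True) # pos_word u"
  "pos_word (u @ v) = pos_word u @ pos_word v"
  by (simp_all add: pos_word_def)

lemma pos_word_in_lists: "u \<in> lists A \<Longrightarrow> pos_word u \<in> lists (A \<times> UNIV)"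
  by (induction u) auto

lemma mon_cong_pos_word:
  assumes "(u, v) \<in> mon_cong A R"
  shows "(pos_word u, pos_word v) \<in> mon_cong (A \<times> UNIV) (signed_rels A R)"
proof -
  have eq: "concat (map (\<lambda>a. [(a, True)]) u) = pos_word u" for u :: "'a list"
    by (induction u) auto
  have "(concat (map (\<lambda>a. [(a, True)]) u), concat (map (\<lambda>a. [(a, True)]) v))
      \<in> mon_cong (A \<times> UNIV) (signed_rels A R)"
    by (rule mon_cong_concat_map[OF assms])
      (auto simp: eq signed_rels_def pos_word_in_lists simp flip: pos_word_def intro!: mon_cong.rel)
  then show ?thesis
    by (simp only: eq)
qed

section \<open>Signed permutations\<close>

text \<open>Permutations enter through their inverses, so composition appears reversed in
  \<open>sgn_perm_compose\<close>: \<open>sgn_perm X I p\<close> sends the basis vector of \<open>p z\<close> to plus or minus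
  that of \<open>z\<close>, with sign minus iff \<open>p z \<in> I\<close>.\<close>

definition sgn_perm :: "'a set \<Rightarrow> 'a set \<Rightarrow> ('a \<Rightarrow> 'a) \<Rightarrow> ('a \<Rightarrow> real) \<Rightarrow> 'a \<Rightarrow> real" where
  "sgn_perm X I p = (\<lambda>v\<in>vsp X. \<lambda>z. if z \<in> X then (if p z \<in> I then - v (p z) else v (p z)) else 0)"

lemma sgn_perm_in_vsp: "v \<in> vsp X \<Longrightarrow> sgn_perm X I p v \<in> vsp X"
  by (simp add: sgn_perm_def vsp_def)

lemma sgn_perm_cong:
  assumes "I \<inter> X = J \<inter> X" "\<And>z. z \<in> X \<Longrightarrow> p z = q z" "p \<in> X \<rightarrow> X"
  shows "sgn_perm X I p = sgn_perm X J q"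
  unfolding sgn_perm_def
proof (rule restrict_ext, rule ext)
  fix v :: "'a \<Rightarrow> real" and z
  have "z \<in> X \<Longrightarrow> q z \<in> X"
    using assms(2,3) by (metis PiE)
  then show "(if z \<in> X then if p z \<in> I then - v (p z) else v (p z) else 0)
      = (if z \<in> X then if q z \<in> J then - v (q z) else v (q z) else (0::real))"
    using assms(1,2) by auto
qed

lemma sgn_perm_id: "sgn_perm X {} id = (\<lambda>v\<in>vsp X. v)"
  unfolding sgn_perm_def by (rule restrict_ext, rule ext) (simp add: vsp_def)

text \<open>Two sign changes cancel, hence the exclusive or. The set \<open>I\<close> is tested at
  \<open>p z\<close>, one application of \<open>q\<close> before \<open>J\<close>; this is the
  cocycle rule modulo 2.\<close>

lemma sgn_perm_compose:
  assumes "p \<in> X \<rightarrow> X" "\<And>z. z \<in> X \<Longrightarrow> q (p z) \<in> K \<longleftrightarrow> (p z \<in> I) \<noteq> (q (p z) \<in> J)"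
  shows "compose (vsp X) (sgn_perm X I p) (sgn_perm X J q) = sgn_perm X K (q \<circ> p)"
  unfolding compose_def
proof (subst (3) sgn_perm_def, rule restrict_ext, rule ext)
  fix v :: "'a \<Rightarrow> real" and z
  assume "v \<in> vsp X"
  then have "sgn_perm X I p (sgn_perm X J q v) z
      = (if z \<in> X then if p z \<in> I then - sgn_perm X J q v (p z) else sgn_perm X J q v (p z) else 0)"
    by (simp add: sgn_perm_def[of X I] sgn_perm_in_vsp)
  moreover have "sgn_perm X J q v (p z) = (if q (p z) \<in> J then - v (q (p z)) else v (q (p z)))" if "z \<in> X"
    using that \<open>v \<in> vsp X\<close> assms(1) by (simp add: sgn_perm_def Pi_iff)
  ultimately show "sgn_perm X I p (sgn_perm X J q v) z
      = (if z \<in> X then if (q \<circ> p) z \<in> K then - v ((q \<circ> p) z) else v ((q \<circ> p) z) else 0)"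
    using assms(2)[of z] by auto
qed

text \<open>Both maps are applied to the basis vector at \<open>p z\<close> and compared at the
  coordinate \<open>z\<close>: a nonzero value forces \<open>q z = p z\<close>, and its sign decides
  membership in \<open>I\<close> and \<open>J\<close>.\<close>

lemma sgn_perm_eqD:
  assumes eq: "sgn_perm X I p = sgn_perm X J q" and pq: "bij_betw p X X" "bij_betw q X X"
  shows "\<forall>z\<in>X. p z = q z" "I \<inter> X = J \<inter> X"
proof -
  have *: "p z = q z \<and> (p z \<in> I \<longleftrightarrow> q z \<in> J)" if z: "z \<in> X" for z
  proof -
    have "p z \<in> X"
      using bij_betwE[OF pq(1)] z by blast
    then have v: "basis_vec (p z) \<in> vsp X"
      by (auto simp: vsp_def basis_vec_def)
    have "sgn_perm X I p (basis_vec (p z)) z = sgn_perm X J q (basis_vec (p z)) z"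
      by (simp only: eq)
    then have "(if p z \<in> I then - basis_vec (p z) (p z) else basis_vec (p z) (p z))
        = (if q z \<in> J then - basis_vec (p z) (q z) else basis_vec (p z) (q z))"
      unfolding sgn_perm_def restrict_apply'[OF v] by (simp only: z if_True)
    moreover have "basis_vec (p z) (p z) = 1" "basis_vec (p z) (q z) = (if q z = p z then 1 else 0)"
      by (simp_all add: basis_vec_def)
    ultimately show ?thesis
      by (cases "q z = p z") (simp_all split: if_split_asm)
  qed
  then show "\<forall>z\<in>X. p z = q z" by blast
  have "x \<in> I \<longleftrightarrow> x \<in> J" if "x \<in> X" for x
  proof -
    have "x \<in> p ` X"
      using that by (simp only: bij_betw_imp_surj_on[OF pq(1)])
    then obtain z where "z \<in> X" "x = p z"
      by blast
    then show ?thesis using * by metis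
  qed
  then show "I \<inter> X = J \<inter> X" by blast
qed

lemma compose_sgn_perm_inv_into:
  assumes "bij_betw p X X"
  shows "compose (vsp X) (sgn_perm X I p) (sgn_perm X (inv_into X p ` (I \<inter> X)) (inv_into X p)) = (\<lambda>v\<in>vsp X. v)"
    (is ?one)
    and "compose (vsp X) (sgn_perm X (inv_into X p ` (I \<inter> X)) (inv_into X p)) (sgn_perm X I p) = (\<lambda>v\<in>vsp X. v)"
    (is ?two)
proof -
  let ?q = "inv_into X p"
  have q: "bij_betw ?q X X"
    using assms by (rule bij_betw_inv_into)
  have qp: "?q (p z) = z" and pq: "p (?q z) = z" if "z \<in> X" for z
    using that assms by (auto simp: bij_betw_inv_into_left bij_betw_inv_into_right)
  have p_in: "p \<in> X \<rightarrow> X" and q_in: "?q \<in> X \<rightarrow> X"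
    using assms q by (auto simp: bij_betw_def)
  have mem: "?q z \<in> ?q ` (I \<inter> X) \<longleftrightarrow> z \<in> I" if "z \<in> X" for z
    using that by (auto dest: bij_betw_imp_inj_on[OF q, THEN inj_onD])
  have "compose (vsp X) (sgn_perm X I p) (sgn_perm X (?q ` (I \<inter> X)) ?q) = sgn_perm X {} (?q \<circ> p)"
    using p_in by (intro sgn_perm_compose) (auto simp del: image_iff simp: mem Pi_iff)
  also have "\<dots> = sgn_perm X {} id"
    using p_in q_in by (intro sgn_perm_cong) (auto simp: qp Pi_iff)
  finally show ?one by (simp add: sgn_perm_id)
  have "compose (vsp X) (sgn_perm X (?q ` (I \<inter> X)) ?q) (sgn_perm X I p) = sgn_perm X {} (p \<circ> ?q)"
    using q_in by (intro sgn_perm_compose) (auto simp del: image_iff simp: mem pq)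
  also have "\<dots> = sgn_perm X {} id"
    using p_in q_in by (intro sgn_perm_cong) (auto simp: pq Pi_iff)
  finally show ?two by (simp add: sgn_perm_id)
qed

section \<open>The general linear group\<close>

text \<open>The linear bijections form a subgroup of \<open>BijGroup (vsp X)\<close>. The inverse is
  linear because the bijection sends both sides of each linearity equation to the same
  vector.\<close>

lemma group_GL: "group (GL X)"
proof -
  let ?add = "\<lambda>u v :: 'a \<Rightarrow> real. \<lambda>a. u a + v a" and ?sc = "\<lambda>c v :: 'a \<Rightarrow> real. \<lambda>a. c * v a"
  define H where "H = {h \<in> Bij (vsp X).
      (\<forall>u\<in>vsp X. \<forall>v\<in>vsp X. h (?add u v) = ?add (h u) (h v)) \<and>
      (\<forall>c. \<forall>v\<in>vsp X. h (?sc c v) = ?sc c (h v))}"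
  have add: "?add u v \<in> vsp X" if "u \<in> vsp X" "v \<in> vsp X" for u v
    using that by (simp add: vsp_def)
  have sc: "?sc c v \<in> vsp X" if "v \<in> vsp X" for c v
    using that by (simp add: vsp_def)
  interpret B: group "BijGroup (vsp X)" by (rule group_BijGroup)
  have "subgroup H (BijGroup (vsp X))"
  proof (rule B.subgroupI)
    show "H \<subseteq> carrier (BijGroup (vsp X))"
      by (auto simp: H_def BijGroup_def)
    have "(\<lambda>v\<in>vsp X. v) \<in> H"
      by (simp add: H_def id_Bij add sc)
    then show "H \<noteq> {}" by blast
  next
    fix h assume h: "h \<in> H"
    then have b: "h \<in> Bij (vsp X)" by (simp add: H_def)
    let ?k = "inv_into (vsp X) h"
    have k: "?k v \<in> vsp X" "h (?k v) = v" if "v \<in> vsp X" for v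
      using b that by (auto simp: Bij_def bij_betw_def inv_into_into f_inv_into_f)
    have kh: "?k (h v) = v" if "v \<in> vsp X" for v
      using b that by (auto simp: Bij_def bij_betw_def)
    have "?k (?add u v) = ?add (?k u) (?k v)" if "u \<in> vsp X" "v \<in> vsp X" for u v
    proof -
      have "h (?add (?k u) (?k v)) = ?add u v"
        using h k that by (simp add: H_def)
      then show ?thesis
        using kh[OF add[OF k(1)[OF that(1)] k(1)[OF that(2)]]] by simp
    qed
    moreover have "?k (?sc c v) = ?sc c (?k v)" if "v \<in> vsp X" for c v
    proof -
      have "h (?sc c (?k v)) = ?sc c v"
        using h k that by (simp add: H_def)
      then show ?thesis
        using kh[OF sc[OF k(1)[OF that]], of c] by simp
    qed
    ultimately show "inv\<^bsub>BijGroup (vsp X)\<^esub> h \<in> H"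
      using b by (simp add: inv_BijGroup H_def restrict_inv_into_Bij add sc)
  next
    fix h k assume h: "h \<in> H" and k: "k \<in> H"
    then have b: "h \<in> Bij (vsp X)" "k \<in> Bij (vsp X)" by (simp_all add: H_def)
    have "k v \<in> vsp X" if "v \<in> vsp X" for v
      using Bij_imp_funcset[OF b(2)] that by blast
    then show "h \<otimes>\<^bsub>BijGroup (vsp X)\<^esub> k \<in> H"
      using b h k by (simp add: BijGroup_def H_def compose_Bij) (simp add: compose_def add sc)
  qed
  then have "group (BijGroup (vsp X)\<lparr>carrier := H\<rparr>)"
    by (rule B.subgroup_imp_group)
  then show ?thesis
    by (simp add: GL_def H_def)
qed

lemma sgn_perm_in_GL:
  assumes "bij_betw p X X"
  shows "sgn_perm X I p \<in> carrier (GL X)"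
proof -
  have add: "(\<lambda>a. u a + v a) \<in> vsp X" if "u \<in> vsp X" "v \<in> vsp X" for u v :: "'a \<Rightarrow> real"
    using that by (simp add: vsp_def)
  have sc: "(\<lambda>a. c * v a) \<in> vsp X" if "v \<in> vsp X" for c and v :: "'a \<Rightarrow> real"
    using that by (simp add: vsp_def)
  let ?q = "sgn_perm X (inv_into X p ` (I \<inter> X)) (inv_into X p)"
  have "bij_betw (sgn_perm X I p) (vsp X) (vsp X)"
  proof (rule bij_betw_byWitness[where f' = ?q])
    show "\<forall>v\<in>vsp X. ?q (sgn_perm X I p v) = v"
      using compose_sgn_perm_inv_into(2)[OF assms, of I] by (metis compose_eq restrict_apply')
    show "\<forall>v\<in>vsp X. sgn_perm X I p (?q v) = v"
      using compose_sgn_perm_inv_into(1)[OF assms, of I] by (metis compose_eq restrict_apply')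
  qed (auto simp: sgn_perm_in_vsp)
  moreover have "sgn_perm X I p \<in> extensional (vsp X)"
    by (simp add: sgn_perm_def)
  ultimately have "sgn_perm X I p \<in> Bij (vsp X)"
    by (simp add: Bij_def)
  moreover have "sgn_perm X I p (\<lambda>a. u a + v a) = (\<lambda>a. sgn_perm X I p u a + sgn_perm X I p v a)"
    if "u \<in> vsp X" "v \<in> vsp X" for u v
    using that by (simp add: sgn_perm_def add fun_eq_iff)
  moreover have "sgn_perm X I p (\<lambda>a. c * v a) = (\<lambda>a. c * sgn_perm X I p v a)"
    if "v \<in> vsp X" for c v
    using that by (simp add: sgn_perm_def sc fun_eq_iff)
  ultimately show ?thesis
    by (simp add: GL_def)
qed

lemma mult_GL:
  "g \<in> carrier (GL X) \<Longrightarrow> h \<in> carrier (GL X) \<Longrightarrow> g \<otimes>\<^bsub>GL X\<^esub> h = compose (vsp X) g h"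
  by (simp add: GL_def BijGroup_def)

lemma one_GL: "\<one>\<^bsub>GL X\<^esub> = sgn_perm X {} id"
  unfolding sgn_perm_id by (simp add: GL_def BijGroup_def)

lemma inv_GL_sgn_perm:
  assumes "bij_betw p X X"
  shows "inv\<^bsub>GL X\<^esub> (sgn_perm X I p) = sgn_perm X (inv_into X p ` (I \<inter> X)) (inv_into X p)"
  using assms bij_betw_inv_into[OF assms]
  by (intro group.inv_equality[OF group_GL])
    (simp_all add: sgn_perm_in_GL mult_GL compose_sgn_perm_inv_into one_GL sgn_perm_id)

text \<open>Links the description of \<open>psi_gen\<close> by values on the basis with signed
  permutations: at the coordinate \<open>z\<close> only the summand \<open>y = p z\<close>
  survives.\<close>

lemma lin_ext_signed_basis:
  assumes "finite X" "bij_betw p X X"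
  shows "lin_ext X (\<lambda>y z. if y = x then - basis_vec (inv_into X p y) z else basis_vec (inv_into X p y) z)
    = sgn_perm X {x} p"
  unfolding lin_ext_def sgn_perm_def
proof (rule restrict_ext, rule ext)
  fix v :: "'a \<Rightarrow> real" and z
  let ?t = "\<lambda>y. v y * (if y = x then - basis_vec (inv_into X p y) z else basis_vec (inv_into X p y) z)"
  have z: "inv_into X p y = z \<longleftrightarrow> z \<in> X \<and> y = p z" if "y \<in> X" for y
    using bij_betw_inv_into_left[OF assms(2), of z] bij_betw_inv_into_right[OF assms(2) that]
      bij_betwE[OF bij_betw_inv_into[OF assms(2)]] that by auto
  have t: "?t y = (if y = p z then (if z \<in> X then if p z \<in> {x} then - v (p z) else v (p z) else 0) else 0)"
    if "y \<in> X" for y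
  proof -
    have "basis_vec (inv_into X p y) z = (if z \<in> X \<and> y = p z then 1 else 0)"
      using z[OF that] by (auto simp: basis_vec_def)
    then show ?thesis by (simp only:) simp
  qed
  have "(\<Sum>y\<in>X. ?t y) = (\<Sum>y\<in>X. if y = p z then (if z \<in> X then if p z \<in> {x} then - v (p z) else v (p z) else 0) else 0)"
    by (rule sum.cong[OF HOL.refl t])
  also have "\<dots> = (if z \<in> X then if p z \<in> {x} then - v (p z) else v (p z) else 0)"
    using bij_betwE[OF assms(2)] by (simp add: sum.delta[OF assms(1)])
  finally show "(\<Sum>y\<in>X. ?t y) = (if z \<in> X then if p z \<in> {x} then - v (p z) else v (p z) else 0)" .
qed

lemma mset_eq_if_size_eq: "A \<subseteq># B \<Longrightarrow> size A = size B \<Longrightarrow> A = B"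
  using mset_subset_size[of A B] by (auto simp: subset_mset.less_le)

section \<open>Words over a solution\<close>

locale sym_solution =
  fixes X :: "'a set" and S :: "'a \<times> 'a \<Rightarrow> 'a \<times> 'a"
  assumes finite_X: "finite X" and nondeg: "nondegenerate X S" and symm: "symmetric_sol X S"
begin

abbreviation f where "f \<equiv> sol_f S"
abbreviation g where "g \<equiv> sol_g S"
abbreviation \<phi> where "\<phi> \<equiv> sol_phi X S"
abbreviation word_eq (infix "\<simeq>" 50) where "u \<simeq> v \<equiv> (u, v) \<in> mon_cong X (sol_rels X S)"

lemma S_eq: "S (x, y) = (g x y, f y x)"
  by (simp add: sol_f_def sol_g_def)

lemma bij_f: "x \<in> X \<Longrightarrow> bij_betw (f x) X X"
  using nondeg by (simp add: nondegenerate_def)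

lemma f_in: "x \<in> X \<Longrightarrow> y \<in> X \<Longrightarrow> f x y \<in> X"
  using bij_betwE[OF bij_f] by blast

lemma g_in: "x \<in> X \<Longrightarrow> y \<in> X \<Longrightarrow> g x y \<in> X"
  using nondeg bij_betwE unfolding nondegenerate_def by blast

lemma f_inj: "x \<in> X \<Longrightarrow> y \<in> X \<Longrightarrow> z \<in> X \<Longrightarrow> f x y = f x z \<longleftrightarrow> y = z"
  using bij_betw_imp_inj_on[OF bij_f] by (auto dest: inj_onD)

lemma bij_\<phi>: "x \<in> X \<Longrightarrow> bij_betw (\<phi> x) X X"
  unfolding sol_phi_def by (rule bij_betw_inv_into[OF bij_f])

lemma \<phi>_in: "x \<in> X \<Longrightarrow> y \<in> X \<Longrightarrow> \<phi> x y \<in> X"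
  using bij_betwE[OF bij_\<phi>] by blast

lemma f_\<phi>: "x \<in> X \<Longrightarrow> y \<in> X \<Longrightarrow> f x (\<phi> x y) = y"
  unfolding sol_phi_def by (rule bij_betw_inv_into_right[OF bij_f])

lemma \<phi>_f: "x \<in> X \<Longrightarrow> y \<in> X \<Longrightarrow> \<phi> x (f x y) = y"
  unfolding sol_phi_def by (rule bij_betw_inv_into_left[OF bij_f])

lemma S_S:
  assumes "x \<in> X" "y \<in> X"
  shows "g (g x y) (f y x) = x" "f (f y x) (g x y) = y"
proof -
  have "S (S (x, y)) = (x, y)"
    using symm assms by (simp add: symmetric_sol_def involutive_def)
  then show "g (g x y) (f y x) = x" "f (f y x) (g x y) = y"
    by (simp_all add: S_eq)
qed

text \<open>This is the third component of the braid relation at \<open>(z, x, y)\<close>; it says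
  that both sides of a defining relation act alike.\<close>

lemma f_f:
  assumes "x \<in> X" "y \<in> X" "z \<in> X"
  shows "f (f y x) (f (g x y) z) = f y (f x z)"
proof -
  have "act12 S (act23 S (act12 S (z, x, y))) = act23 S (act12 S (act23 S (z, x, y)))"
    using symm assms by (simp add: symmetric_sol_def braided_def)
  then show ?thesis
    by (simp add: act12_def act23_def S_eq)
qed

text \<open>If \<open>f y x = y\<close>, involutivity gives \<open>f y (g x y) = y\<close>, and
  injectivity of \<open>f y\<close> forces \<open>g x y = x\<close>. Hence a pair is not frozen iff
  its multiset \<open>{f y x, y}\<close> is squarefree.\<close>

lemma frozen_iff:
  assumes "x \<in> X" "y \<in> X"
  shows "frozen S x y \<longleftrightarrow> f y x = y"
proof
  assume *: "f y x = y"
  then have "f y (g x y) = f y x"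
    using S_S(2)[OF assms] by simp
  then have "g x y = x"
    using assms by (simp add: f_inj g_in)
  with * show "frozen S x y"
    by (simp add: frozen_def S_eq)
qed (simp add: frozen_def S_eq)

section \<open>The right action of words and its cocycle\<close>

lemma bij_fold_f: "w \<in> lists X \<Longrightarrow> bij_betw (fold f w) X X"
proof (induction w)
  case (Cons x w)
  then show ?case
    using bij_betw_trans[OF bij_f, of x "fold f w" X] by (simp add: comp_def)
qed simp

lemma fold_f_in: "w \<in> lists X \<Longrightarrow> z \<in> X \<Longrightarrow> fold f w z \<in> X"
  using bij_betwE[OF bij_fold_f] by blast

lemma fold_f_inj: "w \<in> lists X \<Longrightarrow> y \<in> X \<Longrightarrow> z \<in> X \<Longrightarrow> fold f w y = fold f w z \<longleftrightarrow> y = z"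
  using bij_betw_imp_inj_on[OF bij_fold_f] by (auto dest: inj_onD)

text \<open>The map \<open>wms\<close> is the bijective 1-cocycle from the structure monoid to the free
  commutative monoid on \<open>X\<close>; its reduction modulo 2 records the signs of \<open>\<psi>\<close>.\<close>

primrec wms :: "'a list \<Rightarrow> 'a multiset" where
  "wms [] = {#}"
| "wms (x # w) = add_mset (fold f w x) (wms w)"

lemma wms_append: "wms (u @ v) = image_mset (fold f v) (wms u) + wms v"
  by (induction u) auto

lemma size_wms: "size (wms w) = length w"
  by (induction w) auto

lemma set_wms: "w \<in> lists X \<Longrightarrow> set_mset (wms w) \<subseteq> X"
  by (induction w) (auto simp: fold_f_in)

text \<open>For a defining relation both multisets are \<open>{f y x, y}\<close> by involutivity,
  and the actions agree by \<open>f_f\<close>. Both claims are proved in one induction because the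
  multiset of a product involves the action of its right factor.\<close>

lemma wms_fold_cong:
  assumes "u \<simeq> v"
  shows "wms u = wms v \<and> (\<forall>z\<in>X. fold f u z = fold f v z)"
  using assms
proof (induction rule: mon_cong.induct)
  case (rel u v)
  then obtain x y where "u = [x, y]" "v = [g x y, f y x]" "x \<in> X" "y \<in> X"
    by (auto simp: sol_rels_def)
  then show ?case
    by (simp add: S_S(2) f_f add_mset_commute)
next
  case (app u v u' v')
  have "set_mset (wms v) \<subseteq> X"
    using mon_cong_in_lists[OF app.hyps(1)] set_wms by blast
  then have "image_mset (fold f u') (wms v) = image_mset (fold f v') (wms v)"
    using app.IH(2) by (intro image_mset_cong) blast
  moreover have "fold f v z \<in> X" if "z \<in> X" for z
    using mon_cong_in_lists[OF app.hyps(1)] fold_f_in that by blast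
  ultimately show ?case
    using app.IH by (simp add: wms_append)
qed auto

text \<open>Presentations leave out the relations of frozen pairs, but for these the two sides are
  the same word.\<close>

lemma word_eq_swap:
  assumes "x \<in> X" "y \<in> X"
  shows "[x, y] \<simeq> [g x y, f y x]"
proof (cases "S (x, y) = (x, y)")
  case True
  then show ?thesis
    using assms by (simp add: S_eq mon_cong.refl)
next
  case False
  then show ?thesis
    using assms by (intro mon_cong.rel) (auto simp: sol_rels_def f_in g_in)
qed

lemma word_eq_head:
  assumes "w \<in> lists X" "a \<in># wms w"
  shows "\<exists>x v. x \<in> X \<and> v \<in> lists X \<and> w \<simeq> x # v \<and> fold f v x = a"
  using assms
proof (induction w)
  case (Cons y u)
  show ?case
  proof (cases "a = fold f u y")
    case True
    moreover have "y # u \<simeq> y # u"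
      using Cons.hyps by (intro mon_cong.refl) simp
    ultimately show ?thesis
      using Cons.hyps by blast
  next
    case False
    then obtain x v where v: "x \<in> X" "v \<in> lists X" "u \<simeq> x # v" "fold f v x = a"
      using Cons by auto
    \<comment> \<open>The prescribed element comes from the tail, so induction first moves it to the
      front of the tail. Swapping \<open>y\<close> and \<open>x\<close> then brings it to the first
      letter: by involutivity \<open>f x y\<close> sends \<open>g y x\<close> back to
      \<open>x\<close>.\<close>
    have "y # u \<simeq> [y, x] @ v"
      using mon_cong_Cons[OF v(3) Cons.hyps(1)] by simp
    moreover have "[y, x] @ v \<simeq> [g y x, f x y] @ v"
      using word_eq_swap[OF Cons.hyps(1) v(1)] v(2) by (rule mon_cong_append_right)
    ultimately have "y # u \<simeq> g y x # (f x y # v)"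
      using mon_cong.trans by fastforce
    moreover have "fold f (f x y # v) (g y x) = a"
      using Cons.hyps(1) v by (simp add: S_S(2))
    moreover have "g y x \<in> X" "f x y # v \<in> lists X"
      using Cons.hyps v by (simp_all add: f_in g_in)
    ultimately show ?thesis
      by blast
  qed
qed simp

text \<open>The word \<open>v\<close> is rearranged so that its first letter contributes the same
  element as \<open>x\<close>. The tails then have equal multisets, so they are equal by induction
  and act alike; injectivity of this action identifies the first letters.\<close>

lemma word_eq_if_wms_eq:
  assumes "u \<in> lists X" "v \<in> lists X" "wms u = wms v"
  shows "u \<simeq> v"
  using assms
proof (induction u arbitrary: v)
  case Nil
  then have "length v = 0"
    using size_wms[of v] by simp
  then show ?case
    by (simp add: mon_cong.refl)
next
  case (Cons x u)
  have "fold f u x \<in># wms v"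
    using Cons.prems(2) by (metis wms.simps(2) union_single_eq_member)
  then obtain y w where w: "y \<in> X" "w \<in> lists X" "v \<simeq> y # w" "fold f w y = fold f u x"
    using word_eq_head Cons.prems(1) by blast
  have "wms (x # u) = wms (y # w)"
    using wms_fold_cong[OF w(3)] Cons.prems(2) by simp
  then have uw: "u \<simeq> w"
    using Cons.IH[OF w(2)] w(4) by simp
  then have "fold f w y = fold f w x"
    using wms_fold_cong[OF uw] w(4) Cons.hyps(1) by simp
  then have "x = y"
    using fold_f_inj[OF w(2)] w(1) Cons.hyps(1) by simp
  then show ?case
    using mon_cong_Cons[OF uw Cons.hyps(1)] w(3) mon_cong.sym mon_cong.trans by metis
qed

lemma ex_word_wms:
  assumes "set_mset M \<subseteq> X"
  shows "\<exists>w\<in>lists X. wms w = M"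
  using assms
proof (induction M)
  case (add a M)
  then obtain w where w: "w \<in> lists X" "wms w = M"
    by auto
  have "a \<in> fold f w ` X"
    using add.prems bij_betw_imp_surj_on[OF bij_fold_f[OF w(1)]] by simp
  then obtain x where "x \<in> X" "fold f w x = a"
    by blast
  then show ?case
    using w by (intro bexI[of _ "x # w"]) auto
qed (auto intro: bexI[of _ "[]"])

text \<open>The missing part of \<open>M\<close> is pulled back along the action of
  \<open>v\<close>, since appending \<open>v\<close> transports the multiset of the left factor by
  this action.\<close>

lemma ex_word_append_wms:
  assumes v: "v \<in> lists X" and M: "set_mset M \<subseteq> X" "wms v \<subseteq># M"
  shows "\<exists>u\<in>lists X. wms (u @ v) = M"
proof -
  let ?h = "inv_into X (fold f v)"
  have bij: "bij_betw (fold f v) X X"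
    using v by (rule bij_fold_f)
  have sub: "set_mset (M - wms v) \<subseteq> X"
    using M(1) by (meson in_diffD subset_iff)
  have "set_mset (image_mset ?h (M - wms v)) \<subseteq> X"
    using sub bij_betwE[OF bij_betw_inv_into[OF bij]] by auto
  then obtain u where u: "u \<in> lists X" "wms u = image_mset ?h (M - wms v)"
    using ex_word_wms by blast
  have "image_mset (fold f v) (image_mset ?h (M - wms v)) = image_mset id (M - wms v)"
    unfolding multiset.map_comp
    using sub bij_betw_inv_into_right[OF bij] by (intro image_mset_cong) auto
  then have "wms (u @ v) = M"
    using M(2) by (simp add: wms_append u(2))
  then show ?thesis
    using u(1) by blast
qed

section \<open>Signed words\<close>

definition letter :: "'a \<times> bool \<Rightarrow> 'a \<Rightarrow> 'a" where
  "letter c = (if snd c then f (fst c) else \<phi> (fst c))"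

text \<open>For an inverse letter the point is the one that makes the contributions of
  \<open>x\<close> and its formal inverse cancel in either order: the letter \<open>x\<close> is
  sent to \<open>\<phi> x x\<close> by the inverse, and \<open>f x\<close> sends
  \<open>\<phi> x x\<close> to \<open>x\<close>.\<close>

definition letter_pt :: "'a \<times> bool \<Rightarrow> 'a" where
  "letter_pt c = (if snd c then fst c else \<phi> (fst c) (fst c))"

text \<open>The extension of the cocycle \<open>wms\<close> to signed words: multiplicities become
  integers, and an inverse letter counts negatively.\<close>

primrec stot :: "('a \<times> bool) list \<Rightarrow> 'a \<Rightarrow> int" where
  "stot [] = (\<lambda>_. 0)"
| "stot (c # w) = (\<lambda>z. stot w z + (if snd c then 1 else - 1) * of_bool (z = fold letter w (letter_pt c)))"

abbreviation sword_eq (infix "\<simeq>\<^sub>G" 50) where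
  "u \<simeq>\<^sub>G v \<equiv> (u, v) \<in> mon_cong (X \<times> UNIV) (signed_rels X (sol_rels X S))"

lemma bij_letter: "c \<in> X \<times> UNIV \<Longrightarrow> bij_betw (letter c) X X"
  using bij_f bij_\<phi> by (auto simp: letter_def)

lemma letter_pt_in: "c \<in> X \<times> UNIV \<Longrightarrow> letter_pt c \<in> X"
  by (auto simp: letter_pt_def \<phi>_in)

lemma bij_fold_letter: "w \<in> lists (X \<times> UNIV) \<Longrightarrow> bij_betw (fold letter w) X X"
proof (induction w)
  case (Cons c w)
  then show ?case
    using bij_betw_trans[OF bij_letter, of c "fold letter w" X] by (simp add: comp_def)
qed simp

lemma fold_letter_in: "w \<in> lists (X \<times> UNIV) \<Longrightarrow> z \<in> X \<Longrightarrow> fold letter w z \<in> X"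
  using bij_betwE[OF bij_fold_letter] by blast

lemma fold_letter_inj:
  "w \<in> lists (X \<times> UNIV) \<Longrightarrow> y \<in> X \<Longrightarrow> z \<in> X \<Longrightarrow> fold letter w y = fold letter w z \<longleftrightarrow> y = z"
  using bij_betw_imp_inj_on[OF bij_fold_letter] by (auto dest: inj_onD)

text \<open>Evaluation at an image under \<open>v\<close> avoids inverse actions: the total of
  \<open>u\<close> is transported along \<open>v\<close>, which is injective on
  \<open>X\<close>.\<close>

lemma stot_append:
  assumes "u \<in> lists (X \<times> UNIV)" "v \<in> lists (X \<times> UNIV)" "z \<in> X"
  shows "stot (u @ v) (fold letter v z) = stot u z + stot v (fold letter v z)"
  using assms(1)
proof (induction u)
  case (Cons c u)
  then show ?case
    using assms fold_letter_inj[OF assms(2,3) fold_letter_in[OF _ letter_pt_in], of u c] by simp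
qed simp

lemma fold_letter_pos_word: "fold letter (pos_word u) = fold f u"
  by (induction u) (auto simp: letter_def)

lemma stot_pos_word: "stot (pos_word u) z = int (count (wms u) z)"
  by (induction u) (auto simp: letter_pt_def fold_letter_pos_word)

lemma stot_fold_cong:
  assumes "u \<simeq>\<^sub>G v"
  shows "\<forall>z\<in>X. fold letter u z = fold letter v z \<and> stot u z = stot v z"
  using assms
proof (induction rule: mon_cong.induct)
  case (rel u v)
  consider u' v' where "(u', v') \<in> sol_rels X S" "u = pos_word u'" "v = pos_word v'"
    | a b where "a \<in> X" "u = [(a, b), (a, \<not> b)]" "v = []"
    using rel.hyps(1) by (auto simp: signed_rels_def pos_word_def)
  then show ?case
  proof cases
    case 1
    then have "u' \<in> lists X" "v' \<in> lists X"
      by (auto simp: sol_rels_def f_in g_in)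
    then have "u' \<simeq> v'"
      using 1(1) by (intro mon_cong.rel)
    then show ?thesis
      using wms_fold_cong[of u' v'] 1 by (simp add: fold_letter_pos_word stot_pos_word)
  next
    case 2
    then show ?thesis
      by (cases b) (auto simp: letter_def letter_pt_def f_\<phi> \<phi>_f)
  qed
next
  case (app u v u' v')
  have in_lists: "u \<in> lists (X \<times> UNIV)" "v \<in> lists (X \<times> UNIV)"
      "u' \<in> lists (X \<times> UNIV)" "v' \<in> lists (X \<times> UNIV)"
    using mon_cong_in_lists[OF app.hyps(1)] mon_cong_in_lists[OF app.hyps(2)] by simp_all
  show ?case
  proof (intro ballI conjI)
    fix z assume z: "z \<in> X"
    show "fold letter (u @ u') z = fold letter (v @ v') z"
      using app.IH z fold_letter_in[OF in_lists(2) z] by simp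
    \<comment> \<open>Since \<open>stot_append\<close> speaks only of images under the second word,
      \<open>z\<close> is pulled back along \<open>v'\<close>.\<close>
    have "z \<in> fold letter v' ` X"
      using z bij_betw_imp_surj_on[OF bij_fold_letter[OF in_lists(4)]] by simp
    then obtain y where y: "y \<in> X" "z = fold letter v' y"
      by blast
    then have y': "z = fold letter u' y"
      using app.IH(2) by simp
    have "stot (u @ u') z = stot u y + stot u' z"
      using stot_append[OF in_lists(1,3) y(1)] by (simp only: y')
    also have "\<dots> = stot v y + stot v' z"
      using app.IH y(1) z by simp
    also have "\<dots> = stot (v @ v') z"
      using stot_append[OF in_lists(2,4) y(1)] by (simp only: y(2))
    finally show "stot (u @ u') z = stot (v @ v') z" .
  qed
qed auto

lemma psi_gen_eq: "x \<in> X \<Longrightarrow> psi_gen X S x = sgn_perm X {x} (f x)"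
  unfolding psi_gen_def sol_phi_def by (rule lin_ext_signed_basis[OF finite_X bij_f])

text \<open>The representation is the action together with the cocycle modulo 2, so elements of
  \<open>W\<close> are studied through these two invariants only.\<close>

lemma signed_eval_eq:
  assumes "w \<in> lists (X \<times> UNIV)"
  shows "signed_eval (GL X) (psi_gen X S) w = sgn_perm X {z \<in> X. odd (stot w z)} (fold letter w)"
  using assms
proof (induction w)
  case Nil
  then show ?case
    by (simp add: signed_eval_def one_GL id_def)
next
  case (Cons c w)
  obtain a b where c: "c = (a, b)" "a \<in> X"
    using Cons.hyps(1) by (cases c) auto
  have lc: "(if b then psi_gen X S a else inv\<^bsub>GL X\<^esub> (psi_gen X S a)) = sgn_perm X {letter_pt c} (letter c)"
    using c by (simp add: psi_gen_eq letter_def letter_pt_def inv_GL_sgn_perm[OF bij_f] sol_phi_def)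
  let ?w = "sgn_perm X {z \<in> X. odd (stot w z)} (fold letter w)"
  have "signed_eval (GL X) (psi_gen X S) (c # w)
      = sgn_perm X {letter_pt c} (letter c) \<otimes>\<^bsub>GL X\<^esub> signed_eval (GL X) (psi_gen X S) w"
    unfolding lc[symmetric] by (simp add: signed_eval_def c)
  also have "\<dots> = compose (vsp X) (sgn_perm X {letter_pt c} (letter c)) ?w"
    unfolding Cons.IH using Cons.hyps
    by (intro mult_GL sgn_perm_in_GL bij_letter bij_fold_letter)
  also have "\<dots> = sgn_perm X {z \<in> X. odd (stot (c # w) z)} (fold letter w \<circ> letter c)"
  proof (rule sgn_perm_compose)
    show "letter c \<in> X \<rightarrow> X"
      using bij_betw_imp_funcset[OF bij_letter] Cons.hyps(1) by blast
    fix z assume "z \<in> X"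
    then have lz: "letter c z \<in> X"
      using bij_betwE[OF bij_letter] Cons.hyps(1) by blast
    \<comment> \<open>Injectivity of the action of \<open>w\<close> matches the point added to the
      total with the single sign change of the letter \<open>c\<close>.\<close>
    then have "fold letter w (letter c z) = fold letter w (letter_pt c) \<longleftrightarrow> letter c z = letter_pt c"
      using Cons.hyps by (intro fold_letter_inj letter_pt_in)
    then show "fold letter w (letter c z) \<in> {z \<in> X. odd (stot (c # w) z)} \<longleftrightarrow>
        (letter c z \<in> {letter_pt c}) \<noteq> (fold letter w (letter c z) \<in> {z \<in> X. odd (stot w z)})"
      using fold_letter_in[OF Cons.hyps(2) lz] by auto
  qed
  finally show ?case
    by (simp add: comp_def)
qed

section \<open>The representation\<close>

abbreviation G where "G \<equiv> struct_group X S"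
abbreviation W where "W \<equiv> W_group X S"
abbreviation gclass where "gclass \<equiv> word_class (X \<times> UNIV) (signed_rels X (sol_rels X S))"
abbreviation sev where "sev \<equiv> signed_eval (GL X) (psi_gen X S)"

lemma group_G: "group G"
  unfolding struct_group_def by (rule group_grp_pres)

lemma carrier_G: "carrier G = gclass ` lists (X \<times> UNIV)"
  unfolding struct_group_def grp_pres_def by (rule carrier_mon_pres)

lemma carrier_GE:
  assumes "c \<in> carrier G"
  obtains w where "w \<in> lists (X \<times> UNIV)" "c = gclass w"
  using assms unfolding carrier_G by (rule imageE)

lemma one_G: "\<one>\<^bsub>G\<^esub> = gclass []"
  unfolding struct_group_def grp_pres_def by (rule one_mon_pres)

lemma mult_G:
  "u \<in> lists (X \<times> UNIV) \<Longrightarrow> v \<in> lists (X \<times> UNIV) \<Longrightarrow> gclass u \<otimes>\<^bsub>G\<^esub> gclass v = gclass (u @ v)"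
  unfolding struct_group_def grp_pres_def by (rule mult_mon_pres)

lemma sev_in_GL: "w \<in> lists (X \<times> UNIV) \<Longrightarrow> sev w \<in> carrier (GL X)"
  by (simp add: signed_eval_eq sgn_perm_in_GL bij_fold_letter)

lemma sev_Cons: "sev (c # w) = (if snd c then psi_gen X S (fst c) else inv\<^bsub>GL X\<^esub> (psi_gen X S (fst c))) \<otimes>\<^bsub>GL X\<^esub> sev w"
  by (simp add: signed_eval_def split_beta)

lemma psi_gen_in_GL: "x \<in> X \<Longrightarrow> psi_gen X S x \<in> carrier (GL X)"
  by (simp add: psi_gen_eq sgn_perm_in_GL[OF bij_f])

lemma sev_append:
  assumes "u \<in> lists (X \<times> UNIV)" "v \<in> lists (X \<times> UNIV)"
  shows "sev (u @ v) = sev u \<otimes>\<^bsub>GL X\<^esub> sev v"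
proof -
  interpret GL: group "GL X" by (rule group_GL)
  show ?thesis
    using assms(1)
  proof (induction u)
    case Nil
    then show ?case
      using sev_in_GL[OF assms(2)] by (simp add: signed_eval_def)
  next
    case (Cons c u)
    then have "psi_gen X S (fst c) \<in> carrier (GL X)"
      by (auto intro: psi_gen_in_GL)
    then show ?case
      using Cons sev_in_GL assms(2) by (simp add: sev_Cons GL.m_assoc)
  qed
qed

lemma sev_cong:
  assumes "u \<simeq>\<^sub>G v"
  shows "sev u = sev v"
proof -
  have uv: "u \<in> lists (X \<times> UNIV)" "v \<in> lists (X \<times> UNIV)"
    using mon_cong_in_lists[OF assms] by simp_all
  show ?thesis
    unfolding signed_eval_eq[OF uv(1)] signed_eval_eq[OF uv(2)]
    using stot_fold_cong[OF assms] bij_betw_imp_funcset[OF bij_fold_letter[OF uv(1)]]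
    by (intro sgn_perm_cong) auto
qed

text \<open>Evaluation is constant on a class and the class is nonempty, so \<open>the_elem\<close>
  in \<open>psi\<close> picks a determined value.\<close>

lemma psi_gclass:
  assumes "w \<in> lists (X \<times> UNIV)"
  shows "psi X S (gclass w) = sev w"
proof -
  have "sev ` gclass w = {sev w}"
  proof
    show "sev ` gclass w \<subseteq> {sev w}"
      using sev_cong by (metis Image_singleton_iff image_subsetI singletonI)
    show "{sev w} \<subseteq> sev ` gclass w"
      using in_word_class[OF assms] by (metis empty_subsetI image_eqI insert_subset)
  qed
  then show ?thesis
    by (simp add: psi_def)
qed

lemma psi_struct_gen:
  assumes "x \<in> X"
  shows "psi X S (struct_gen X S x) = psi_gen X S x"
proof -
  interpret GL: group "GL X" by (rule group_GL)
  have "psi X S (struct_gen X S x) = sev [(x, True)]"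
    unfolding struct_gen_def grp_gen_def using assms by (intro psi_gclass) simp
  also have "\<dots> = psi_gen X S x"
    using psi_gen_in_GL[OF assms] by (simp add: signed_eval_def)
  finally show ?thesis .
qed

lemma psi_hom: "psi X S \<in> hom G (GL X)"
proof (rule homI)
  fix c assume "c \<in> carrier G"
  then obtain w where "w \<in> lists (X \<times> UNIV)" "c = gclass w"
    by (rule carrier_GE)
  then show "psi X S c \<in> carrier (GL X)"
    by (simp only: psi_gclass sev_in_GL)
next
  fix c d assume c: "c \<in> carrier G" and d: "d \<in> carrier G"
  obtain u where u: "u \<in> lists (X \<times> UNIV)" "c = gclass u"
    using c by (rule carrier_GE)
  obtain v where v: "v \<in> lists (X \<times> UNIV)" "d = gclass v"
    using d by (rule carrier_GE)
  have "u @ v \<in> lists (X \<times> UNIV)"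
    using u(1) v(1) by simp
  then show "psi X S (c \<otimes>\<^bsub>G\<^esub> d) = psi X S c \<otimes>\<^bsub>GL X\<^esub> psi X S d"
    unfolding u(2) v(2) mult_G[OF u(1) v(1)] by (simp only: psi_gclass u(1) v(1) sev_append)
qed

lemma carrier_W: "carrier W = sev ` lists (X \<times> UNIV)"
  unfolding W_group_def by (simp add: carrier_G image_image psi_gclass)

lemma mult_W: "x \<otimes>\<^bsub>W\<^esub> y = x \<otimes>\<^bsub>GL X\<^esub> y"
  by (simp add: W_group_def)

lemma one_W: "\<one>\<^bsub>W\<^esub> = \<one>\<^bsub>GL X\<^esub>"
  by (simp add: W_group_def)

lemma group_W: "group W"
proof -
  interpret group_hom G "GL X" "psi X S"
    by (simp add: group_hom_def group_hom_axioms_def group_G group_GL psi_hom)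
  show ?thesis
    unfolding W_group_def using img_is_subgroup by (rule subgroup.subgroup_is_group) (rule group_GL)
qed

lemma psi_epi: "psi X S \<in> epi G W"
  using psi_hom by (auto simp: epi_def hom_def W_group_def)

lemma finite_W: "finite (carrier W)"
proof (rule finite_subset)
  show "finite ((\<lambda>(I, p). sgn_perm X I p) ` (Pow X \<times> (X \<rightarrow>\<^sub>E X)))"
    using finite_X by (simp add: finite_PiE)
  show "carrier W \<subseteq> (\<lambda>(I, p). sgn_perm X I p) ` (Pow X \<times> (X \<rightarrow>\<^sub>E X))"
  proof
    fix c assume "c \<in> carrier W"
    then obtain w where w: "w \<in> lists (X \<times> UNIV)" "c = sev w"
      unfolding carrier_W by blast
    \<comment> \<open>Restricting the action to \<open>X\<close> changes nothing in
      \<open>sgn_perm\<close> and places it in the finite set of extensional functions.\<close>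
    let ?I = "{z \<in> X. odd (stot w z)}" and ?p = "restrict (fold letter w) X"
    have fs: "fold letter w \<in> X \<rightarrow> X"
      using bij_betw_imp_funcset[OF bij_fold_letter[OF w(1)]] .
    then have "c = sgn_perm X ?I ?p"
      unfolding w(2) signed_eval_eq[OF w(1)] by (intro sgn_perm_cong) auto
    moreover have "?I \<in> Pow X" "?p \<in> X \<rightarrow>\<^sub>E X"
      using fs by (auto simp: Pi_iff)
    ultimately show "c \<in> (\<lambda>(I, p). sgn_perm X I p) ` (Pow X \<times> (X \<rightarrow>\<^sub>E X))"
      by (intro image_eqI[of _ _ "(?I, ?p)"]) simp_all
  qed
qed

section \<open>Positive words and their lengths\<close>

definition ev :: "'a list \<Rightarrow> ('a \<Rightarrow> real) \<Rightarrow> 'a \<Rightarrow> real" where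
  "ev u = sev (pos_word u)"

text \<open>By \<open>ev_eq\<close> this is the sign pattern of \<open>ev u\<close>, hence an
  invariant of the element of \<open>W\<close>.\<close>

definition odds :: "'a list \<Rightarrow> 'a set" where
  "odds u = {z \<in> X. odd (count (wms u) z)}"

abbreviation Y where "Y \<equiv> psi_gen X S ` X"

lemma ev_eq: "u \<in> lists X \<Longrightarrow> ev u = sgn_perm X (odds u) (fold f u)"
  by (simp add: ev_def signed_eval_eq pos_word_in_lists stot_pos_word fold_letter_pos_word odds_def)

lemma ev_foldr: "ev u = foldr (\<otimes>\<^bsub>W\<^esub>) (map (psi_gen X S) u) \<one>\<^bsub>W\<^esub>"
  unfolding mult_W[abs_def] one_W by (induction u) (auto simp: ev_def signed_eval_def)

lemma ev_Nil: "ev [] = \<one>\<^bsub>W\<^esub>"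
  by (simp add: ev_foldr)

lemma ev_Cons: "ev (x # u) = psi_gen X S x \<otimes>\<^bsub>W\<^esub> ev u"
  by (simp add: ev_foldr)

lemma ev_in_W: "u \<in> lists X \<Longrightarrow> ev u \<in> carrier W"
  unfolding carrier_W ev_def by (intro imageI pos_word_in_lists)

lemma ev_append: "u \<in> lists X \<Longrightarrow> v \<in> lists X \<Longrightarrow> ev (u @ v) = ev u \<otimes>\<^bsub>W\<^esub> ev v"
  by (simp add: ev_def sev_append pos_word_in_lists mult_W)

lemma ev_singleton: "x \<in> X \<Longrightarrow> ev [x] = psi_gen X S x"
  by (auto simp: ev_eq psi_gen_eq odds_def intro!: arg_cong[where f = "\<lambda>I. sgn_perm X I (f x)"])

lemma ev_cong: "u \<simeq> v \<Longrightarrow> ev u = ev v"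
  unfolding ev_def by (intro sev_cong mon_cong_pos_word)

lemma Y_subset: "Y \<subseteq> carrier W"
proof (rule image_subsetI)
  fix x assume "x \<in> X"
  then show "psi_gen X S x \<in> carrier W"
    using ev_in_W[of "[x]"] by (simp add: ev_singleton)
qed

lemma odds_eq_if_ev_eq:
  assumes "u \<in> lists X" "v \<in> lists X" "ev u = ev v"
  shows "odds u = odds v"
proof -
  have "sgn_perm X (odds u) (fold f u) = sgn_perm X (odds v) (fold f v)"
    using assms by (simp add: ev_eq)
  then have "odds u \<inter> X = odds v \<inter> X"
    by (rule sgn_perm_eqD(2)) (use assms bij_fold_f in auto)
  then show ?thesis
    by (auto simp: odds_def)
qed

text \<open>A finite submonoid of a group is a subgroup, so the images of positive words already
  exhaust \<open>W\<close>.\<close>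

lemma inv_psi_gen:
  assumes "x \<in> X"
  shows "\<exists>u\<in>lists X. inv\<^bsub>GL X\<^esub> (psi_gen X S x) = ev u"
proof -
  interpret W: group W by (rule group_W)
  interpret GL: group "GL X" by (rule group_GL)
  have x: "psi_gen X S x \<in> carrier W"
    using Y_subset assms by blast
  have rep: "replicate k x \<in> lists X" for k
    using assms by (induction k) auto
  have x1: "[x] \<in> lists X"
    using assms by simp
  have pow: "psi_gen X S x [^]\<^bsub>W\<^esub> k = ev (replicate k x)" for k :: nat
  proof (induction k)
    case (Suc k)
    then have "psi_gen X S x [^]\<^bsub>W\<^esub> Suc k = ev (replicate k x) \<otimes>\<^bsub>W\<^esub> ev [x]"
      using assms by (simp add: ev_singleton)
    also have "\<dots> = ev (replicate (Suc k) x)"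
      using ev_append[OF rep x1, of k] by (simp only: replicate_append_same replicate_Suc)
    finally show ?case .
  qed (simp add: ev_Nil)
  define N where "N = order W - 1"
  have "order W = Suc N"
    using W.order_gt_0_iff_finite finite_W by (simp add: N_def)
  then have "psi_gen X S x [^]\<^bsub>W\<^esub> N \<otimes>\<^bsub>W\<^esub> psi_gen X S x = \<one>\<^bsub>W\<^esub>"
    using W.pow_order_eq_1[OF x] by simp
  then have "ev (replicate N x) \<otimes>\<^bsub>GL X\<^esub> psi_gen X S x = \<one>\<^bsub>GL X\<^esub>"
    by (simp add: pow mult_W one_W)
  then have "inv\<^bsub>GL X\<^esub> (psi_gen X S x) = ev (replicate N x)"
    using psi_gen_in_GL[OF assms] sev_in_GL[OF pos_word_in_lists[OF rep]]
    by (intro GL.inv_equality) (simp_all add: ev_def)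
  then show ?thesis
    using rep by blast
qed

lemma carrier_W_pos: "carrier W = ev ` lists X"
proof
  show "ev ` lists X \<subseteq> carrier W"
    using ev_in_W by blast
  have "\<exists>u\<in>lists X. sev w = ev u" if "w \<in> lists (X \<times> UNIV)" for w
    using that
  proof (induction w)
    case Nil
    show ?case
      by (intro bexI[of _ "[]"]) (simp_all add: ev_def)
  next
    case (Cons c w)
    then obtain u where u: "u \<in> lists X" "sev w = ev u"
      by blast
    have "fst c \<in> X"
      using Cons.hyps(1) by auto
    then obtain v where v: "v \<in> lists X"
      "(if snd c then psi_gen X S (fst c) else inv\<^bsub>GL X\<^esub> (psi_gen X S (fst c))) = ev v"
      using inv_psi_gen ev_singleton[of "fst c"] by (cases "snd c") (auto intro: that[of "[fst c]"])
    then have "sev (c # w) = ev (v @ u)"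
      using u by (simp add: sev_Cons ev_append mult_W)
    then show ?case
      using u(1) v(1) by (intro bexI[of _ "v @ u"]) simp_all
  qed
  then show "carrier W \<subseteq> ev ` lists X"
    unfolding carrier_W by (metis imageI image_subsetI)
qed

lemma generate_Y: "generate W Y = carrier W"
proof
  interpret W: group W by (rule group_W)
  show "generate W Y \<subseteq> carrier W"
    using Y_subset by (rule W.generate_incl)
  have "ev u \<in> generate W Y" if "u \<in> lists X" for u
    using that
  proof (induction u)
    case Nil
    show ?case
      by (simp add: ev_Nil generate.one)
  next
    case (Cons x u)
    then show ?case
      by (simp add: ev_Cons generate.eng generate.incl)
  qed
  then show "carrier W \<subseteq> generate W Y"
    unfolding carrier_W_pos by blast
qed

lemma fin_gen_W: "fin_gen_group W Y"
  by (simp add: fin_gen_group_def group_W finite_W Y_subset generate_Y)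

section \<open>The length function of \<open>W\<close>\<close>

lemma lists_Y: "lists Y = map (psi_gen X S) ` lists X"
  by (rule lists_image)

lemma ell_le: "u \<in> lists X \<Longrightarrow> ell W Y (ev u) \<le> length u"
  unfolding ell_def lists_Y by (rule Least_le) (force simp: ev_foldr)

lemma ell_attained:
  assumes "c \<in> carrier W"
  shows "\<exists>u\<in>lists X. c = ev u \<and> ell W Y c = length u"
proof -
  obtain v where v: "v \<in> lists X" "c = ev v"
    using assms unfolding carrier_W_pos by blast
  let ?P = "\<lambda>k. \<exists>ws\<in>lists Y. length ws = k \<and> foldr (\<otimes>\<^bsub>W\<^esub>) ws \<one>\<^bsub>W\<^esub> = c"
  have "?P (length v)"
    using v by (intro bexI[of _ "map (psi_gen X S) v"]) (auto simp: ev_foldr lists_Y)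
  then have "?P (ell W Y c)"
    unfolding ell_def by (rule LeastI)
  then show ?thesis
    unfolding lists_Y by (auto simp: ev_foldr)
qed

section \<open>Simple words\<close>

text \<open>Inclusion in \<open>mset_set X\<close> encodes that the multiset is squarefree.\<close>

definition simple :: "'a list \<Rightarrow> bool" where
  "simple u \<longleftrightarrow> u \<in> lists X \<and> wms u \<subseteq># mset_set X"

lemma finite_odds: "finite (odds u)"
  using finite_X by (simp add: odds_def)

lemma mset_odds_subseteq: "mset_set (odds u) \<subseteq># wms u"
  by (auto simp: subseteq_mset_def count_mset_set' odds_def Suc_le_eq simp del: count_greater_zero_iff intro: odd_pos)

text \<open>Each sign needs a letter of its own: this lower bound on lengths is attained exactly by
  the simple words.\<close>

lemma card_odds_le: "card (odds u) \<le> length u"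
  using size_mset_mono[OF mset_odds_subseteq] by (simp add: size_wms)

text \<open>The set of odd elements is always contained in \<open>wms u\<close>, whose size is the
  length. Equal sizes therefore mean that every multiplicity is 0 or 1.\<close>

lemma simple_iff_card:
  assumes "u \<in> lists X"
  shows "simple u \<longleftrightarrow> card (odds u) = length u"
proof
  assume "simple u"
  then have le: "count (wms u) z \<le> (if z \<in> X then 1 else 0)" for z
    using mset_subset_eq_count[of "wms u" "mset_set X" z] finite_X
    by (simp add: simple_def count_mset_set')
  have bit: "n = of_bool (odd n)" if "n \<le> 1" for n :: nat
  proof -
    have "n = 0 \<or> n = 1"
      using that by arith
    then show ?thesis by auto
  qed
  have "count (wms u) z = count (mset_set (odds u)) z" for z
  proof (cases "z \<in> X")
    case True
    then have "count (wms u) z \<le> 1"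
      using le[of z] by (simp only: if_True)
    then have "count (wms u) z = of_bool (odd (count (wms u) z))"
      by (rule bit)
    also have "\<dots> = count (mset_set (odds u)) z"
      using True finite_odds[of u] by (simp add: count_mset_set' odds_def)
    finally show ?thesis .
  next
    case False
    then show ?thesis
      using le[of z] finite_odds[of u] by (simp add: count_mset_set' odds_def)
  qed
  then have "wms u = mset_set (odds u)"
    by (rule multiset_eqI)
  then show "card (odds u) = length u"
    using size_wms[of u] by simp
next
  assume "card (odds u) = length u"
  then have "size (mset_set (odds u)) = size (wms u)"
    by (simp add: size_wms)
  then have "wms u = mset_set (odds u)"
    using mset_eq_if_size_eq[OF mset_odds_subseteq] by simp
  moreover have "mset_set (odds u) \<subseteq># mset_set X"
    using finite_X by (intro subset_imp_msubset_mset_set) (auto simp: odds_def)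
  ultimately show "simple u"
    using assms by (simp add: simple_def)
qed

lemma simple_wms: "simple u \<Longrightarrow> wms u = mset_set (odds u)"
proof -
  assume "simple u"
  then have "size (mset_set (odds u)) = size (wms u)"
    using simple_iff_card[of u] by (simp add: simple_def size_wms)
  then show ?thesis
    using mset_eq_if_size_eq[OF mset_odds_subseteq] by simp
qed

lemma simple_append:
  assumes "u \<in> lists X" "v \<in> lists X" "simple (u @ v)"
  shows "simple u" "simple v"
proof -
  have le: "image_mset (fold f v) (wms u) + wms v \<subseteq># mset_set X"
    using assms(3) by (simp add: simple_def wms_append)
  then show "simple v"
    using assms(2) subset_mset.order_trans[OF mset_subset_eq_add_right] by (auto simp: simple_def)
  have "count (wms u) z \<le> count (mset_set X) z" for z
  proof (cases "z \<in># wms u")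
    case True
    then have z: "z \<in> X"
      using set_wms[OF assms(1)] by blast
    \<comment> \<open>The action of \<open>v\<close> may only merge elements of
      \<open>wms u\<close>, so multiplicities do not drop when passing to the image, and the image
      is squarefree.\<close>
    have "count (wms u) z \<le> (\<Sum>y\<in>fold f v -` {fold f v z} \<inter> set_mset (wms u). count (wms u) y)"
      using True by (intro member_le_sum) auto
    also have "\<dots> = count (image_mset (fold f v) (wms u)) (fold f v z)"
      by (simp add: count_image_mset)
    also have "\<dots> \<le> count (mset_set X) (fold f v z)"
      using mset_subset_eq_count[OF le, of "fold f v z"] by simp
    also have "\<dots> \<le> count (mset_set X) z"
      using z finite_X by (simp add: count_mset_set')
    finally show ?thesis .
  qed (simp add: not_in_iff)
  then show "simple u"
    using assms(1) by (simp add: simple_def subseteq_mset_def)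
qed

lemma simple_singleton: "x \<in> X \<Longrightarrow> simple [x]"
  using finite_X by (simp add: simple_def)

lemma simple_Nil: "simple []"
  by (simp add: simple_def)

text \<open>Every positive word with the same image has the same sign pattern, hence at least
  \<open>card (odds u)\<close> letters.\<close>

lemma ell_simple:
  assumes "simple u"
  shows "ell W Y (ev u) = length u"
proof -
  have u: "u \<in> lists X"
    using assms by (simp add: simple_def)
  obtain v where v: "v \<in> lists X" "ev u = ev v" "ell W Y (ev u) = length v"
    using ell_attained[OF ev_in_W[OF u]] by blast
  have "length u = card (odds v)"
    using assms simple_iff_card[OF u] odds_eq_if_ev_eq[OF u v(1,2)] by simp
  then show ?thesis
    using card_odds_le[of v] ell_le[OF u] v(3) by simp
qed

text \<open>The multiset of a simple word can be read off from the signs of its image. This makes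
  the structure monoid visible inside \<open>W\<close>.\<close>

lemma simple_word_eq:
  assumes "simple u" "simple v" "ev u = ev v"
  shows "u \<simeq> v"
proof -
  have uv: "u \<in> lists X" "v \<in> lists X"
    using assms by (simp_all add: simple_def)
  have "wms u = wms v"
    using simple_wms[OF assms(1)] simple_wms[OF assms(2)] odds_eq_if_ev_eq[OF uv assms(3)] by simp
  then show ?thesis
    using uv by (intro word_eq_if_wms_eq)
qed

lemma simple_if_ell_add:
  assumes "u \<in> lists X" "v \<in> lists X" "simple x" "ev u \<otimes>\<^bsub>W\<^esub> ev v = ev x" "length u + length v = length x"
  shows "simple (u @ v)"
proof -
  have x: "x \<in> lists X" and uv: "u @ v \<in> lists X"
    using assms by (simp_all add: simple_def)
  have "odds (u @ v) = odds x"
    using assms by (intro odds_eq_if_ev_eq x uv) (simp add: ev_append)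
  then show ?thesis
    using assms simple_iff_card[OF x] simple_iff_card[OF uv] by simp
qed

section \<open>The balanced element\<close>

text \<open>By \<open>word_eq_if_wms_eq\<close> the choice affects neither the class of the word in
  the monoid nor its image in \<open>W\<close>.\<close>

definition \<Delta> :: "'a list" where
  "\<Delta> = (SOME w. w \<in> lists X \<and> wms w = mset_set X)"

lemma \<Delta>: "\<Delta> \<in> lists X" "wms \<Delta> = mset_set X"
proof -
  have "\<exists>w\<in>lists X. wms w = mset_set X"
    by (rule ex_word_wms) (simp add: finite_X)
  then have "\<exists>w. w \<in> lists X \<and> wms w = mset_set X"
    by blast
  then have "\<Delta> \<in> lists X \<and> wms \<Delta> = mset_set X"
    unfolding \<Delta>_def by (rule someI_ex)
  then show "\<Delta> \<in> lists X" "wms \<Delta> = mset_set X"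
    by simp_all
qed

lemma simple_\<Delta>: "simple \<Delta>"
  by (simp add: simple_def \<Delta>)

abbreviation simples where "simples \<equiv> ev ` {u. simple u}"

lemma simples_subset: "simples \<subseteq> carrier W"
  using ev_in_W by (auto simp: simple_def)

text \<open>Shortest words for \<open>a\<close> and \<open>b\<close> concatenate to a word with the
  signs of \<open>\<Delta>\<close> and the length of \<open>\<Delta>\<close>. Such a word is simple,
  and so are its two parts.\<close>

lemma factors_\<Delta>_simple:
  assumes "a \<in> carrier W" "b \<in> carrier W" "ev \<Delta> = a \<otimes>\<^bsub>W\<^esub> b"
    and ell: "ell W Y (ev \<Delta>) = ell W Y a + ell W Y b"
  shows "a \<in> simples" "b \<in> simples"
proof -
  obtain u where u: "u \<in> lists X" "a = ev u" "ell W Y a = length u"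
    using ell_attained[OF assms(1)] by blast
  obtain v where v: "v \<in> lists X" "b = ev v" "ell W Y b = length v"
    using ell_attained[OF assms(2)] by blast
  have "simple (u @ v)"
    using assms(3) ell u v ell_simple[OF simple_\<Delta>]
    by (intro simple_if_ell_add[OF u(1) v(1) simple_\<Delta>]) simp_all
  then show "a \<in> simples" "b \<in> simples"
    using simple_append[OF u(1) v(1)] u(2) v(2) by simp_all
qed

text \<open>The word \<open>v\<close> is extended on the left to a word with multiset
  \<open>X\<close>, which equals \<open>\<Delta>\<close> in the monoid. All words involved are
  simple, so lengths add.\<close>

lemma simple_complement:
  assumes "simple v"
  shows "\<exists>a\<in>carrier W. ev \<Delta> = a \<otimes>\<^bsub>W\<^esub> ev v \<and> ell W Y (ev \<Delta>) = ell W Y a + ell W Y (ev v)"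
proof -
  have v: "v \<in> lists X"
    using assms by (simp add: simple_def)
  have "\<exists>u\<in>lists X. wms (u @ v) = mset_set X"
    using assms by (intro ex_word_append_wms v) (simp_all add: simple_def finite_X)
  then obtain u where u: "u \<in> lists X" "wms (u @ v) = mset_set X"
    by blast
  then have uv: "simple (u @ v)"
    using v by (simp add: simple_def)
  have "\<Delta> \<simeq> u @ v"
    using u v \<Delta> by (intro word_eq_if_wms_eq) simp_all
  then have "ev \<Delta> = ev (u @ v)"
    by (rule ev_cong)
  moreover have "ell W Y (ev (u @ v)) = ell W Y (ev u) + ell W Y (ev v)"
    using ell_simple[OF uv] ell_simple[OF simple_append(1)[OF u(1) v uv]] ell_simple[OF assms] by simp
  ultimately show ?thesis
    using ev_append[OF u(1) v] ev_in_W[OF u(1)] by auto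
qed

lemma right_factors_\<Delta>: "right_factors W Y (ev \<Delta>) = simples"
proof
  show "right_factors W Y (ev \<Delta>) \<subseteq> simples"
    unfolding right_factors_def using factors_\<Delta>_simple(2) by blast
  show "simples \<subseteq> right_factors W Y (ev \<Delta>)"
    unfolding right_factors_def using simple_complement simples_subset by blast
qed

text \<open>Every right factor \<open>b\<close> has the left factor \<open>a\<close> with \<open>ev \<Delta> = a b\<close> as complement, so there are
  at least as many left factors as right factors.\<close>

lemma left_factors_\<Delta>: "left_factors W Y (ev \<Delta>) = simples"
proof -
  interpret W: group W by (rule group_W)
  let ?L = "left_factors W Y (ev \<Delta>)"
  have sub: "?L \<subseteq> simples"
    unfolding left_factors_def using factors_\<Delta>_simple(1) by blast
  have fin: "finite simples"
    using finite_subset[OF simples_subset finite_W] .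
  have "\<forall>b\<in>simples. \<exists>a. a \<in> ?L \<and> ev \<Delta> = a \<otimes>\<^bsub>W\<^esub> b"
    unfolding left_factors_def using simple_complement simples_subset by blast
  then obtain h where h: "\<And>b. b \<in> simples \<Longrightarrow> h b \<in> ?L \<and> ev \<Delta> = h b \<otimes>\<^bsub>W\<^esub> b"
    by metis
  have "inj_on h simples"
  proof (rule inj_onI)
    fix b c assume b: "b \<in> simples" and c: "c \<in> simples" and eq: "h b = h c"
    have "h b \<in> carrier W"
      using h[OF b] by (simp add: left_factors_def)
    moreover have "h b \<otimes>\<^bsub>W\<^esub> b = h b \<otimes>\<^bsub>W\<^esub> c"
      using h[OF b] h[OF c] eq by simp
    moreover have "b \<in> carrier W" "c \<in> carrier W"
      using b c simples_subset by blast+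
    ultimately show "b = c"
      using W.Units_l_cancel[of "h b" b c] W.Units_eq by simp
  qed
  then have "card simples \<le> card ?L"
    using h finite_subset[OF sub fin] by (intro card_inj_on_le[of h]) auto
  then show ?thesis
    using sub fin by (intro card_seteq)
qed

lemma balanced_\<Delta>: "balanced W Y (ev \<Delta>)"
  by (simp add: balanced_def ev_in_W \<Delta> left_factors_\<Delta> right_factors_\<Delta>)

lemma D_factors_\<Delta>: "D_factors W Y (ev \<Delta>) = simples"
  by (simp add: D_factors_def left_factors_\<Delta>)

lemma generate_simples: "generate W simples = carrier W"
proof
  interpret W: group W by (rule group_W)
  show "generate W simples \<subseteq> carrier W"
    using simples_subset by (rule W.generate_incl)
  have "Y \<subseteq> simples"
    using ev_singleton simple_singleton by force
  then show "carrier W \<subseteq> generate W simples"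
    using W.mono_generate[of Y simples] generate_Y by simp
qed

text \<open>A generator \<open>x\<close> is sent to the simple element \<open>psi_gen X S x\<close>,
  a simple element to a simple word for it. Defining relations equate simple words, and products
  with additive lengths lift to simple words, so both substitutions respect the relations.\<close>

lemma struct_monoid_iso: "struct_monoid X S \<cong> factor_monoid W Y (ev \<Delta>)"
proof -
  define Q where "Q = {([v, v'], [v'']) | v v' v''.
      v \<in> simples \<and> v' \<in> simples \<and> v'' \<in> simples \<and>
      v \<otimes>\<^bsub>W\<^esub> v' = v'' \<and> ell W Y v + ell W Y v' = ell W Y v''} \<union> {([\<one>\<^bsub>W\<^esub>], [])}"
  \<comment> \<open>Any simple word for \<open>d\<close> serves: two of them are equal in the monoid
    by \<open>simple_word_eq\<close>.\<close>
  define k where "k d = (SOME u. simple u \<and> ev u = d)" for d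
  have k: "simple (k d)" "ev (k d) = d" if "d \<in> simples" for d
    using someI_ex[of "\<lambda>u. simple u \<and> ev u = d"] that unfolding k_def by auto
  have gen_eq: "concat (map (\<lambda>x. [psi_gen X S x]) u) = map (psi_gen X S) u" for u
    by (induction u) auto
  have mult: "([ev u, ev v], [ev (u @ v)]) \<in> mon_cong simples Q"
    if "u \<in> lists X" "v \<in> lists X" "simple (u @ v)" for u v
  proof -
    have uv: "simple u" "simple v"
      using simple_append[OF that] .
    have s: "ev u \<in> simples" "ev v \<in> simples" "ev (u @ v) \<in> simples"
      using uv that(3) by blast+
    have "ell W Y (ev u) + ell W Y (ev v) = ell W Y (ev (u @ v))"
      by (simp add: ell_simple uv that(3))
    then have "([ev u, ev v], [ev (u @ v)]) \<in> Q"
      unfolding Q_def using s ev_append[OF that(1,2)]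
      by (intro UnI1 CollectI exI conjI HOL.refl) (simp_all only:)
    then show ?thesis
      using s by (intro mon_cong.rel) simp_all
  qed
  \<comment> \<open>In the monoid of factors, the generators along a simple word multiply to the
    single letter of its image, since all suffixes are again simple.\<close>
  have collapse: "(map (psi_gen X S) u, [ev u]) \<in> mon_cong simples Q" if "simple u" for u
  proof -
    have "u \<in> lists X"
      using that by (simp add: simple_def)
    then show ?thesis
      using that
    proof (induction u)
      case Nil
      have "\<one>\<^bsub>W\<^esub> \<in> simples"
        using ev_Nil simple_Nil by force
      then have "([\<one>\<^bsub>W\<^esub>], []) \<in> mon_cong simples Q"
        by (intro mon_cong.rel) (auto simp: Q_def)
      then show ?case
        by (simp add: ev_Nil mon_cong.sym)
    next
      case (Cons x u)
      have xu: "[x] \<in> lists X" "simple ([x] @ u)"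
        using Cons by simp_all
      have "simple u"
        using simple_append(2)[OF xu(1) Cons.hyps(2) xu(2)] .
      moreover have "ev [x] \<in> simples"
        using simple_singleton[OF Cons.hyps(1)] by blast
      ultimately have "(ev [x] # map (psi_gen X S) u, ev [x] # [ev u]) \<in> mon_cong simples Q"
        using Cons.IH by (intro mon_cong_Cons) simp_all
      then show ?case
        using mult[OF xu(1) Cons.hyps(2) xu(2)] ev_singleton[OF Cons.hyps(1)]
        by (auto intro: mon_cong.trans)
    qed
  qed
  have "mon_pres X (sol_rels X S) \<cong> mon_pres simples Q"
  proof (rule mon_pres_iso[where h = "\<lambda>x. [psi_gen X S x]" and k = k])
    show "[psi_gen X S x] \<in> lists simples" if "x \<in> X" for x
      using simple_singleton[OF that] ev_singleton[OF that] by force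
    show "k d \<in> lists X" if "d \<in> simples" for d
      using k(1)[OF that] by (simp add: simple_def)
    show "(concat (map (\<lambda>x. [psi_gen X S x]) u), concat (map (\<lambda>x. [psi_gen X S x]) v)) \<in> mon_cong simples Q"
      if rel: "(u, v) \<in> sol_rels X S" for u v
    proof -
      obtain x y where xy: "u = [x, y]" "v = [g x y, f y x]" "x \<in> X" "y \<in> X" "S (x, y) \<noteq> (x, y)"
        using rel by (auto simp: sol_rels_def)
      \<comment> \<open>Defining relations come from pairs that are not frozen; hence
        \<open>[x, y]\<close> is simple, and its image represents both sides.\<close>
      have "f y x \<noteq> y"
        using frozen_iff[OF xy(3,4)] xy(5) by (simp add: frozen_def)
      then have u: "simple u"
        using xy finite_X f_in[OF xy(4,3)] by (auto simp: simple_def count_mset_set' subseteq_mset_def)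
      have uv: "u \<simeq> v"
        using word_eq_swap xy by simp
      then have v: "simple v"
        using u wms_fold_cong[OF uv] mon_cong_in_lists[OF uv] by (simp add: simple_def)
      have "(map (psi_gen X S) u, [ev v]) \<in> mon_cong simples Q"
        using collapse[OF u] ev_cong[OF uv] by simp
      then show ?thesis
        unfolding gen_eq by (rule mon_cong.trans[OF _ mon_cong.sym[OF collapse[OF v]]])
    qed
    show "concat (map k u) \<simeq> concat (map k v)" if uv: "(u, v) \<in> Q" for u v
    proof -
      consider a b c where "u = [a, b]" "v = [c]" "a \<in> simples" "b \<in> simples" "c \<in> simples"
          "a \<otimes>\<^bsub>W\<^esub> b = c" "ell W Y a + ell W Y b = ell W Y c"
        | "u = [\<one>\<^bsub>W\<^esub>]" "v = []"
        using uv by (auto simp: Q_def)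
      then show ?thesis
      proof cases
        case 1
        have ab: "k a \<in> lists X" "k b \<in> lists X"
          using k(1) 1 by (simp_all add: simple_def)
        have "length (k a) + length (k b) = length (k c)"
          using ell_simple[OF k(1)] k(2) 1(3-5,7) by metis
        then have "simple (k a @ k b)"
          using 1 k by (intro simple_if_ell_add[OF ab k(1)[OF 1(5)]]) simp_all
        moreover have "ev (k a @ k b) = ev (k c)"
          using ev_append[OF ab] k(2) 1 by simp
        ultimately show ?thesis
          using 1 simple_word_eq[OF _ k(1)[OF 1(5)]] by simp
      next
        case 2
        have "\<one>\<^bsub>W\<^esub> \<in> simples"
          using ev_Nil simple_Nil by force
        then show ?thesis
          using 2 simple_word_eq[OF k(1) simple_Nil] k(2) ev_Nil by simp
      qed
    qed
    show "concat (map k [psi_gen X S x]) \<simeq> [x]" if "x \<in> X" for x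
    proof -
      have "psi_gen X S x \<in> simples"
        using simple_singleton[OF that] ev_singleton[OF that] by force
      then show ?thesis
        using simple_word_eq[OF k(1) simple_singleton[OF that]] k(2) ev_singleton[OF that] by simp
    qed
    show "(concat (map (\<lambda>x. [psi_gen X S x]) (k d)), [d]) \<in> mon_cong simples Q" if "d \<in> simples" for d
      unfolding gen_eq using collapse[OF k(1)[OF that]] k(2)[OF that] by simp
  qed
  then show ?thesis
    unfolding struct_monoid_def factor_monoid_def D_factors_\<Delta> Q_def .
qed

lemma generating_generated: "generating_generated_group W Y (struct_monoid X S)"
  unfolding generating_generated_group_def
  using fin_gen_W balanced_\<Delta> generate_simples struct_monoid_iso D_factors_\<Delta> by auto

end

section \<open>Property (C)\<close>

lemma even_mset_halves:
  assumes "\<And>z. even (count M z)"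
  shows "\<exists>N. M = N + N"
proof
  define N where "N = (\<Sum>z\<in>set_mset M. replicate_mset (count M z div 2) z)"
  have "count N z = count M z div 2" for z
    unfolding N_def by (simp add: count_sum not_in_iff)
  then show "M = N + N"
    using assms by (intro multiset_eqI) (simp flip: mult_2)
qed

locale sym_solution_C = sym_solution +
  assumes prop_C: "property_C X S"
begin

section \<open>Words with trivial image under Property (C)\<close>

definition squares :: "'a list \<Rightarrow> 'a list" where
  "squares u = concat (map (\<lambda>x. [\<phi> x x, x]) u)"

text \<open>The pair \<open>(\<phi> x x, x)\<close> is frozen because \<open>f x\<close> sends
  \<open>\<phi> x x\<close> to \<open>x\<close>, so Property (C) applies to it.\<close>

lemma f_f_\<phi>:
  assumes "x \<in> X" "z \<in> X"
  shows "f x (f (\<phi> x x) z) = z"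
proof -
  have "frozen S (\<phi> x x) x"
    using assms(1) by (simp add: frozen_iff \<phi>_in f_\<phi>)
  then show ?thesis
    using prop_C assms \<phi>_in by (auto simp: property_C_def)
qed

lemma squares_in_lists: "u \<in> lists X \<Longrightarrow> squares u \<in> lists X"
  by (induction u) (auto simp: squares_def \<phi>_in)

lemma fold_squares: "u \<in> lists X \<Longrightarrow> z \<in> X \<Longrightarrow> fold f (squares u) z = z"
  by (induction u arbitrary: z) (auto simp: squares_def f_f_\<phi>)

lemma wms_squares: "u \<in> lists X \<Longrightarrow> wms (squares u) = mset u + mset u"
proof (induction u)
  case (Cons x u)
  have "squares (x # u) = \<phi> x x # x # squares u"
    by (simp add: squares_def)
  moreover have "x \<in> X" "u \<in> lists X"
    using Cons.prems by simp_all
  ultimately show ?case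
    using Cons.IH fold_squares by (simp add: f_\<phi>)
qed (simp add: squares_def)

lemma ev_squares:
  assumes "u \<in> lists X"
  shows "ev (squares u) = \<one>\<^bsub>W\<^esub>"
proof -
  have "odds (squares u) = {}"
    by (simp add: odds_def wms_squares assms)
  then show ?thesis
    unfolding ev_eq[OF squares_in_lists[OF assms]] one_W one_GL
    using assms bij_betw_imp_funcset[OF bij_fold_f[OF squares_in_lists[OF assms]]]
    by (intro sgn_perm_cong) (simp_all add: fold_squares)
qed

text \<open>The multiset of any positive word is its set of odd elements plus a double
  \<open>N + N\<close>. The double is realised by a word of squares, which acts trivially and
  vanishes in \<open>W\<close>, so a simple word with the same image remains.\<close>

lemma carrier_W_simples: "carrier W = simples"
proof
  interpret W: group W by (rule group_W)
  show "carrier W \<subseteq> simples"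
  proof
    fix c assume "c \<in> carrier W"
    then obtain u where u: "u \<in> lists X" "c = ev u"
      unfolding carrier_W_pos by blast
    have "\<exists>N. wms u - mset_set (odds u) = N + N"
      using set_wms[OF u(1)] finite_odds[of u]
      by (intro even_mset_halves) (auto simp: count_mset_set' odds_def not_in_iff subset_iff, metis even_zero not_in_iff)
    then obtain N where N: "wms u - mset_set (odds u) = N + N" ..
    obtain v where v: "mset v = N"
      using ex_mset by blast
    have "set_mset N \<subseteq> X"
    proof
      fix z assume "z \<in># N"
      then have "z \<in># wms u - mset_set (odds u)"
        by (simp add: N)
      then show "z \<in> X"
        using set_wms[OF u(1)] in_diffD by fast
    qed
    then have vX: "v \<in> lists X"
      using v by (auto simp: lists_eq_set)
    have "set_mset (mset_set (odds u)) \<subseteq> X"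
      using finite_odds[of u] by (auto simp: odds_def)
    then obtain s where s: "s \<in> lists X" "wms s = mset_set (odds u)"
      using ex_word_wms by blast
    have sX: "set_mset (wms s) \<subseteq> X"
      using set_wms[OF s(1)] .
    have simple_s: "simple s"
      using s finite_X by (auto simp: simple_def odds_def intro!: subset_imp_msubset_mset_set)
    \<comment> \<open>Appending squares does not move the elements of \<open>wms s\<close>, so the
      two multisets simply add.\<close>
    have "image_mset (fold f (squares v)) (wms s) = image_mset id (wms s)"
      using sX fold_squares[OF vX] by (intro image_mset_cong) auto
    then have "wms (s @ squares v) = mset_set (odds u) + (N + N)"
      by (simp add: wms_append s(2) wms_squares[OF vX] v)
    also have "\<dots> = wms u"
      unfolding N[symmetric] using mset_odds_subseteq[of u] by simp
    finally have "s @ squares v \<simeq> u"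
      using s(1) squares_in_lists[OF vX] u(1) by (intro word_eq_if_wms_eq) simp_all
    then have "ev (s @ squares v) = c"
      unfolding u(2) by (rule ev_cong)
    then have "c = ev s"
      using ev_append[OF s(1) squares_in_lists[OF vX]] ev_squares[OF vX] ev_in_W[OF s(1)] by simp
    then show "c \<in> simples"
      using simple_s by blast
  qed
qed (rule simples_subset)

text \<open>Each subset of \<open>X\<close> is the sign pattern of a simple word, and the pattern
  determines its image. So the elements of \<open>W\<close> correspond to the subsets of
  \<open>X\<close>.\<close>

lemma order_W: "order W = 2 ^ card X"
proof -
  have "\<exists>u. simple u \<and> wms u = mset_set I" if "I \<subseteq> X" for I
  proof -
    have I: "finite I"
      using that finite_X finite_subset by blast
    then have "\<exists>u\<in>lists X. wms u = mset_set I"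
      using that by (intro ex_word_wms) simp
    then show ?thesis
      using that finite_X by (auto simp: simple_def intro!: subset_imp_msubset_mset_set)
  qed
  then obtain s where s: "\<And>I. I \<subseteq> X \<Longrightarrow> simple (s I) \<and> wms (s I) = mset_set I"
    by metis
  have odds_s: "odds (s I) = I" if "I \<subseteq> X" for I
    using s[OF that] that finite_subset[OF that finite_X] by (auto simp: odds_def count_mset_set')
  have "inj_on (\<lambda>I. ev (s I)) (Pow X)"
  proof (rule inj_onI)
    fix I J assume IJ: "I \<in> Pow X" "J \<in> Pow X" and "ev (s I) = ev (s J)"
    then have "odds (s I) = odds (s J)"
      using s by (intro odds_eq_if_ev_eq) (auto simp: simple_def)
    then show "I = J"
      using IJ odds_s by simp
  qed
  moreover have "(\<lambda>I. ev (s I)) ` Pow X = simples"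
  proof
    show "simples \<subseteq> (\<lambda>I. ev (s I)) ` Pow X"
    proof
      fix c assume "c \<in> simples"
      then obtain u where u: "simple u" "c = ev u"
        by blast
      have o: "odds u \<subseteq> X"
        by (auto simp: odds_def)
      have "wms u = wms (s (odds u))"
        using simple_wms[OF u(1)] s[OF o] by simp
      then have "u \<simeq> s (odds u)"
        using u(1) s[OF o] by (intro word_eq_if_wms_eq) (simp_all add: simple_def)
      then have "c = ev (s (odds u))"
        unfolding u(2) by (rule ev_cong)
      then show "c \<in> (\<lambda>I. ev (s I)) ` Pow X"
        using o by blast
    qed
  qed (use s in blast)
  ultimately have "card (Pow X) = card simples"
    using card_image by fastforce
  then show ?thesis
    by (simp add: order_def carrier_W_simples card_Pow finite_X)
qed

lemma generating_section: "generating_generated_section W Y (struct_monoid X S)"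
  unfolding generating_generated_section_def
  using fin_gen_W balanced_\<Delta> generate_simples struct_monoid_iso D_factors_\<Delta> carrier_W_simples by auto

subsection \<open>The kernel\<close>

text \<open>A constant multiplicity on \<open>X\<close> makes the multiset invariant under all
  permutations of \<open>X\<close>; together with the trivial action this lets the word commute with
  every positive word.\<close>

definition central :: "'a list \<Rightarrow> bool" where
  "central t \<longleftrightarrow> t \<in> lists X \<and> (\<forall>z\<in>X. fold f t z = z) \<and> (\<exists>k. wms t = repeat_mset k (mset_set X))"

lemma central_append:
  assumes "central t" "central t'"
  shows "central (t @ t')"
proof -
  obtain k k' where k: "wms t = repeat_mset k (mset_set X)" "wms t' = repeat_mset k' (mset_set X)"
    using assms by (auto simp: central_def)
  have "image_mset (fold f t') (wms t) = image_mset id (wms t)"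
    using assms set_wms[of t] by (intro image_mset_cong) (auto simp: central_def)
  then have "wms (t @ t') = repeat_mset (k + k') (mset_set X)"
    using k by (simp add: wms_append repeat_mset_distrib)
  then show ?thesis
    using assms by (auto simp: central_def)
qed

text \<open>Neither factor changes the multiset of the other, so both products have multiset
  \<open>wms t + wms u\<close>.\<close>

lemma central_commute:
  assumes "central t" "u \<in> lists X"
  shows "t @ u \<simeq> u @ t"
proof -
  obtain k where k: "wms t = repeat_mset k (mset_set X)"
    using assms(1) by (auto simp: central_def)
  have t: "t \<in> lists X"
    using assms(1) by (simp add: central_def)
  have "image_mset (fold f u) (mset_set X) = mset_set X"
    using bij_fold_f[OF assms(2)] by (simp add: image_mset_mset_set bij_betw_def)
  moreover have "image_mset (fold f u) (repeat_mset k M) = repeat_mset k (image_mset (fold f u) M)" for M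
    by (induction k) simp_all
  ultimately have "image_mset (fold f u) (wms t) = wms t"
    by (simp add: k)
  moreover have "image_mset (fold f t) (wms u) = image_mset id (wms u)"
    using assms set_wms[OF assms(2)] by (intro image_mset_cong) (auto simp: central_def)
  ultimately have "wms (t @ u) = wms (u @ t)"
    by (simp add: wms_append)
  then show ?thesis
    using t assms(2) by (intro word_eq_if_wms_eq) simp_all
qed

text \<open>The squares of an enumeration of \<open>X\<close> form a central word in which every
  element of \<open>X\<close> has multiplicity 2. It contains \<open>x\<close>, so
  \<open>[x]\<close> can be completed on the left to a word equal to it in the monoid.\<close>

lemma ex_central_multiple:
  assumes "x \<in> X"
  shows "\<exists>u\<in>lists X. central (u @ [x])"
proof -
  obtain xs where xs: "mset xs = mset_set X"
    using ex_mset by blast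
  have "set xs = X"
    using arg_cong[OF xs, of set_mset] finite_X by simp
  then have xsX: "xs \<in> lists X"
    by (simp add: lists_eq_set)
  let ?t = "squares xs"
  have t: "?t \<in> lists X" "wms ?t = repeat_mset 2 (mset_set X)"
    using squares_in_lists[OF xsX] wms_squares[OF xsX] by (simp_all add: xs numeral_2_eq_2)
  have "wms [x] \<subseteq># wms ?t"
    using assms finite_X by (simp add: wms_squares[OF xsX] xs)
  then have "\<exists>u\<in>lists X. wms (u @ [x]) = wms ?t"
    using assms set_wms[OF t(1)] by (intro ex_word_append_wms) simp_all
  then obtain u where u: "u \<in> lists X" "wms (u @ [x]) = wms ?t"
    by blast
  then have "u @ [x] \<simeq> ?t"
    using assms t(1) by (intro word_eq_if_wms_eq) simp_all
  then have "central (u @ [x])"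
    using wms_fold_cong[of "u @ [x]" ?t] fold_squares[OF xsX] t u(1) assms
    by (auto simp: central_def simp del: fold_append fold_simps)
  then show ?thesis
    using u(1) by blast
qed

text \<open>The structure group is obtained from the monoid by inverting the central words.\<close>

lemma clear_denominators:
  assumes "w \<in> lists (X \<times> UNIV)"
  shows "\<exists>t u. central t \<and> u \<in> lists X \<and> pos_word t @ w \<simeq>\<^sub>G pos_word u"
  using assms
proof (induction w)
  case Nil
  have "central []"
    by (auto simp: central_def intro: exI[of _ 0])
  then show ?case
    by (intro exI[of _ "[]"]) (simp add: mon_cong.refl)
next
  case (Cons c w)
  then obtain t u where t: "central t" and u: "u \<in> lists X" and tu: "pos_word t @ w \<simeq>\<^sub>G pos_word u"
    by blast
  have tX: "t \<in> lists X"
    using t by (simp add: central_def)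
  have move: "pos_word (t @ v) @ w \<simeq>\<^sub>G pos_word (v @ u)" if v: "v \<in> lists X" for v
  proof -
    have "pos_word (t @ v) @ w \<simeq>\<^sub>G pos_word (v @ t) @ w"
      by (rule mon_cong_append_right[OF mon_cong_pos_word[OF central_commute[OF t v]] Cons.hyps(2)])
    moreover have "pos_word v @ (pos_word t @ w) \<simeq>\<^sub>G pos_word v @ pos_word u"
      by (rule mon_cong_append_left[OF tu pos_word_in_lists[OF v]])
    ultimately show ?thesis
      unfolding pos_word_simps append_assoc by (rule mon_cong.trans)
  qed
  obtain x b where c: "c = (x, b)" "x \<in> X"
    using Cons.hyps(1) by (cases c) auto
  show ?case
  proof (cases b)
    case True
    have "[x] \<in> lists X"
      using c by simp
    moreover have "pos_word t @ c # w = pos_word (t @ [x]) @ w"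
      using True c by simp
    ultimately show ?thesis
      using move[of "[x]"] t u by (intro exI[of _ t] exI[of _ "[x] @ u"]) simp
  next
    case False
    \<comment> \<open>An inverse letter is absorbed by enlarging the denominator: with
      \<open>v x\<close> central, the product of \<open>t v x\<close>, the inverse of
      \<open>x\<close> and \<open>w\<close> reduces to \<open>t v w\<close>, and then to
      \<open>v t w\<close> and \<open>v u\<close>.\<close>
    obtain v where v: "v \<in> lists X" "central (v @ [x])"
      using ex_central_multiple[OF c(2)] by blast
    have "[(x, True), c] \<simeq>\<^sub>G []"
      using False c by (intro mon_cong.rel) (auto simp: signed_rels_def)
    then have "[(x, True), c] @ w \<simeq>\<^sub>G [] @ w"
      using Cons.hyps(2) by (rule mon_cong_append_right)
    moreover have "pos_word (t @ v) \<in> lists (X \<times> UNIV)"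
      using tX v(1) by (intro pos_word_in_lists) simp
    ultimately have "pos_word (t @ v) @ ([(x, True), c] @ w) \<simeq>\<^sub>G pos_word (t @ v) @ ([] @ w)"
      by (rule mon_cong_append_left)
    moreover have "pos_word (t @ v @ [x]) @ c # w = pos_word (t @ v) @ ([(x, True), c] @ w)"
      by simp
    ultimately have "pos_word (t @ v @ [x]) @ c # w \<simeq>\<^sub>G pos_word (v @ u)"
      using move[OF v(1)] by (metis append_Nil mon_cong.trans)
    moreover have "central (t @ v @ [x])"
      using central_append[OF t v(2)] .
    moreover have "v @ u \<in> lists X"
      using v(1) u by simp
    ultimately show ?thesis
      by blast
  qed
qed

text \<open>Action and total together detect the identity of the group. After clearing denominators,
  \<open>w\<close> becomes the quotient of positive words \<open>t\<close> and \<open>u\<close> with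
  equal multisets; these agree in the monoid, and \<open>t\<close> cancels.\<close>

lemma sword_eq_Nil:
  assumes w: "w \<in> lists (X \<times> UNIV)" and fold: "\<And>z. z \<in> X \<Longrightarrow> fold letter w z = z"
    and stot: "\<And>z. z \<in> X \<Longrightarrow> stot w z = 0"
  shows "w \<simeq>\<^sub>G []"
proof -
  obtain t u where t: "central t" and u: "u \<in> lists X" and tu: "pos_word t @ w \<simeq>\<^sub>G pos_word u"
    using clear_denominators[OF w] by blast
  have tX: "t \<in> lists X"
    using t by (simp add: central_def)
  have "count (wms u) z = count (wms t) z" for z
  proof (cases "z \<in> X")
    case True
    have "stot (pos_word u) z = stot (pos_word t @ w) z"
      using stot_fold_cong[OF tu] True by simp
    also have "\<dots> = stot (pos_word t) z"
      using stot_append[OF pos_word_in_lists[OF tX] w True] by (simp add: fold[OF True] stot[OF True])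
    finally show ?thesis
      by (simp add: stot_pos_word)
  next
    case False
    then show ?thesis
      using set_wms[OF u] set_wms[OF tX] by (metis count_eq_zero_iff subsetD)
  qed
  then have "u \<simeq> t"
    using u tX by (intro word_eq_if_wms_eq multiset_eqI)
  then have "pos_word t @ w \<simeq>\<^sub>G pos_word t @ []"
    using mon_cong.trans[OF tu mon_cong_pos_word] by simp
  then show ?thesis
    by (rule mon_cong_signed_cancel_left)
qed

section \<open>The kernel of \<open>psi\<close> and its exact sequence\<close>

lemma sev_eq_one_iff:
  assumes "w \<in> lists (X \<times> UNIV)"
  shows "sev w = \<one>\<^bsub>W\<^esub> \<longleftrightarrow> (\<forall>z\<in>X. fold letter w z = z \<and> even (stot w z))"
proof
  have bij: "bij_betw (fold letter w) X X"
    using assms by (rule bij_fold_letter)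
  assume "sev w = \<one>\<^bsub>W\<^esub>"
  then have eq: "sgn_perm X {z \<in> X. odd (stot w z)} (fold letter w) = sgn_perm X {} id"
    using assms by (simp add: signed_eval_eq one_W one_GL)
  show "\<forall>z\<in>X. fold letter w z = z \<and> even (stot w z)"
    using sgn_perm_eqD[OF eq bij bij_betw_id] by auto
next
  assume "\<forall>z\<in>X. fold letter w z = z \<and> even (stot w z)"
  then show "sev w = \<one>\<^bsub>W\<^esub>"
    unfolding signed_eval_eq[OF assms] one_W one_GL
    using bij_betw_imp_funcset[OF bij_fold_letter[OF assms]] by (intro sgn_perm_cong) auto
qed

abbreviation N where "N \<equiv> N_group X S"

lemma carrier_N: "carrier N = kernel G W (psi X S)"
  by (simp add: N_group_def)

lemma mult_N: "c \<otimes>\<^bsub>N\<^esub> d = c \<otimes>\<^bsub>G\<^esub> d"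
  by (simp add: N_group_def)

lemma one_N: "\<one>\<^bsub>N\<^esub> = gclass []"
  by (simp add: N_group_def one_G)

lemma carrier_NE:
  assumes "c \<in> carrier N"
  obtains w where "w \<in> lists (X \<times> UNIV)" "c = gclass w"
    "\<forall>z\<in>X. fold letter w z = z" "\<forall>z\<in>X. even (stot w z)"
proof -
  have c: "c \<in> carrier G" "psi X S c = \<one>\<^bsub>W\<^esub>"
    using assms by (simp_all add: carrier_N kernel_def)
  obtain w where w: "w \<in> lists (X \<times> UNIV)" "c = gclass w"
    using c(1) by (rule carrier_GE)
  then have "sev w = \<one>\<^bsub>W\<^esub>"
    using c(2) psi_gclass by simp
  then show thesis
    using that[OF w] sev_eq_one_iff[OF w(1)] by blast
qed

lemma gclass_in_N:
  assumes "w \<in> lists (X \<times> UNIV)" "\<And>z. z \<in> X \<Longrightarrow> fold letter w z = z" "\<And>z. z \<in> X \<Longrightarrow> even (stot w z)"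
  shows "gclass w \<in> carrier N"
  using assms sev_eq_one_iff[OF assms(1)] psi_gclass[OF assms(1)]
  by (simp add: carrier_N kernel_def carrier_G)

lemma psi_hom_W: "group_hom G W (psi X S)"
  using psi_epi by (simp add: group_hom_def group_hom_axioms_def group_G group_W epi_def)

lemma group_N: "group N"
  unfolding N_group_def
  using group.subgroup_imp_group[OF group_G group_hom.subgroup_kernel[OF psi_hom_W]] .

lemma short_exact_N: "short_exact N (\<lambda>c. c) G (psi X S) W"
  unfolding short_exact_def
proof (intro conjI)
  show "(\<lambda>c. c) \<in> mon N G"
    by (auto simp: mon_def hom_def carrier_N mult_N kernel_def)
qed (simp_all add: group_N group_G group_W psi_epi carrier_N)

text \<open>At points of \<open>X\<close> the total is the same for all representatives, so an
  arbitrary one may be chosen.\<close>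

definition class_stot :: "('a \<times> bool) list set \<Rightarrow> 'a \<Rightarrow> int" where
  "class_stot c = stot (SOME w. w \<in> c)"

lemma class_stot_gclass:
  assumes "w \<in> lists (X \<times> UNIV)" "z \<in> X"
  shows "class_stot (gclass w) z = stot w z"
proof -
  have "(SOME v. v \<in> gclass w) \<in> gclass w"
    using in_word_class[OF assms(1)] by (rule someI)
  then have "w \<simeq>\<^sub>G (SOME v. v \<in> gclass w)"
    by (simp only: Image_singleton_iff)
  then show ?thesis
    using stot_fold_cong assms(2) unfolding class_stot_def by fastforce
qed

text \<open>On the kernel the action is trivial, so the cocycle is a homomorphism into integer
  functions on \<open>X\<close>. Its values are even, and halving gives a bijection onto the free
  Abelian group.\<close>

lemma N_iso_free_Abelian: "N \<cong> free_Abelian_group {..<card X}"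
proof -
  let ?n = "card X"
  let ?F = "free_Abelian_group {..<?n}"
  obtain e where e: "bij_betw e {..<?n} X"
    using ex_bij_betw_nat_finite[OF finite_X] by (auto simp: atLeast0LessThan)
  have e_in: "e i \<in> X" if "i < ?n" for i
    using bij_betwE[OF e] that by simp
  define H where "H c = (\<Sum>i<?n. frag_cmul (class_stot c (e i) div 2) (frag_of i))" for c
  have lookup_H: "poly_mapping.lookup (H c) j = (if j < ?n then class_stot c (e j) div 2 else 0)" for c j
  proof -
    have "poly_mapping.lookup (H c) j = (\<Sum>i<?n. if i = j then class_stot c (e j) div 2 else 0)"
      unfolding H_def lookup_sum by (intro sum.cong) auto
    then show ?thesis
      by simp
  qed
  have H_carrier: "H c \<in> carrier ?F" for c
    unfolding carrier_free_Abelian_group_iff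
  proof
    fix j assume "j \<in> Poly_Mapping.keys (H c)"
    then have "poly_mapping.lookup (H c) j \<noteq> 0"
      by (simp only: in_keys_iff not_False_eq_True)
    then show "j \<in> {..<?n}"
      unfolding lookup_H lessThan_iff by (rule contrapos_np) (simp only: if_False)
  qed
  have H_mult: "H (c \<otimes>\<^bsub>N\<^esub> d) = H c + H d" if c: "c \<in> carrier N" and d: "d \<in> carrier N" for c d
  proof -
    obtain u where u: "u \<in> lists (X \<times> UNIV)" "c = gclass u"
      "\<forall>z\<in>X. fold letter u z = z" "\<forall>z\<in>X. even (stot u z)"
      using c by (rule carrier_NE)
    obtain v where v: "v \<in> lists (X \<times> UNIV)" "d = gclass v"
      "\<forall>z\<in>X. fold letter v z = z" "\<forall>z\<in>X. even (stot v z)"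
      using d by (rule carrier_NE)
    have uv: "u @ v \<in> lists (X \<times> UNIV)"
      using u(1) v(1) by simp
    have "class_stot (c \<otimes>\<^bsub>N\<^esub> d) z div 2 = class_stot c z div 2 + class_stot d z div 2" if z: "z \<in> X" for z
    proof -
      have "class_stot (c \<otimes>\<^bsub>N\<^esub> d) z = stot (u @ v) z"
        unfolding mult_N u(2) v(2) mult_G[OF u(1) v(1)] by (rule class_stot_gclass[OF uv z])
      also have "\<dots> = stot u z + stot v z"
        using stot_append[OF u(1) v(1) z] by (simp only: bspec[OF v(3) z])
      finally have "class_stot (c \<otimes>\<^bsub>N\<^esub> d) z = class_stot c z + class_stot d z"
        unfolding u(2) v(2) by (simp only: class_stot_gclass[OF u(1) z] class_stot_gclass[OF v(1) z])
      \<comment> \<open>Evenness of one summand makes integer halving additive.\<close>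
      moreover have "even (class_stot c z)"
        unfolding u(2) class_stot_gclass[OF u(1) z] by (rule bspec[OF u(4) z])
      ultimately show ?thesis
        by (simp add: div_plus_div_distrib_dvd_left)
    qed
    then show ?thesis
      by (intro poly_mapping_eqI) (simp add: lookup_H lookup_add e_in)
  qed
  have "H \<in> hom N ?F"
    by (rule homI) (use H_carrier H_mult in simp_all)
  then interpret H: group_hom N ?F H
    by (simp add: group_hom_def group_hom_axioms_def group_N)
  have "kernel N ?F H = {\<one>\<^bsub>N\<^esub>}"
  proof
    show "kernel N ?F H \<subseteq> {\<one>\<^bsub>N\<^esub>}"
    proof
      fix c assume "c \<in> kernel N ?F H"
      then have c: "c \<in> carrier N" and Hc: "H c = 0"
        by (simp_all add: kernel_def)
      obtain w where w: "w \<in> lists (X \<times> UNIV)" "c = gclass w"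
        "\<forall>z\<in>X. fold letter w z = z" "\<forall>z\<in>X. even (stot w z)"
        using c by (rule carrier_NE)
      have "stot w z = 0" if z: "z \<in> X" for z
      proof -
        obtain i where i: "i < ?n" "z = e i"
          using z bij_betw_imp_surj_on[OF e] by blast
        have "class_stot c (e i) div 2 = 0"
          using lookup_H[of c i] Hc i(1) by simp
        then have "stot w z div 2 = 0"
          unfolding i(2)[symmetric] w(2) class_stot_gclass[OF w(1) z] .
        then show ?thesis
          using bspec[OF w(4) z] by (auto elim: evenE)
      qed
      then have "w \<simeq>\<^sub>G []"
        using w(3) by (intro sword_eq_Nil[OF w(1)]) blast+
      then have "gclass w = gclass []"
        by (rule equiv_class_eq[OF equiv_mon_cong])
      then show "c \<in> {\<one>\<^bsub>N\<^esub>}"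
        by (simp only: w(2) one_N singleton_iff)
    qed
  qed (simp add: kernel_def)
  then have "inj_on H (carrier N)"
    by (simp add: H.inj_iff_trivial_ker)
  moreover have "H ` carrier N = carrier ?F"
  proof
    show "carrier ?F \<subseteq> H ` carrier N"
    proof
      fix x assume "x \<in> carrier ?F"
      then have "Poly_Mapping.keys x \<subseteq> {..<?n}"
        by simp
      then show "x \<in> H ` carrier N"
      proof (rule free_Abelian_group_induct[where P = "\<lambda>x. x \<in> H ` carrier N"])
        show "0 \<in> H ` carrier N"
          using H.hom_one H.G.one_closed by (metis imageI one_free_Abelian_group)
      next
        fix x y
        assume "x \<in> H ` carrier N" "y \<in> H ` carrier N" and y: "Poly_Mapping.keys y \<subseteq> {..<?n}"
        then obtain c d where c: "c \<in> carrier N" "x = H c" and d: "d \<in> carrier N" "y = H d"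
          by blast
        have "H (c \<otimes>\<^bsub>N\<^esub> inv\<^bsub>N\<^esub> d) = x - y"
          using c d y by (simp add: H_mult)
        then show "x - y \<in> H ` carrier N"
          using c(1) d(1) by (metis H.G.inv_closed H.G.m_closed imageI)
      next
        fix i
        assume i: "i \<in> {..<?n}"
        have ei: "[e i] \<in> lists X"
          using i e_in by simp
        \<comment> \<open>The square belonging to \<open>e i\<close> lies in the kernel with total 2
          at \<open>e i\<close> alone, so half its total is the basis element
          \<open>frag_of i\<close>.\<close>
        let ?w = "pos_word (squares [e i])"
        have w: "?w \<in> lists (X \<times> UNIV)"
          using squares_in_lists[OF ei] by (rule pos_word_in_lists)
        have st: "stot ?w z = (if z = e i then 2 else 0)" for z
          by (simp add: stot_pos_word wms_squares[OF ei])
        have "gclass ?w \<in> carrier N"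
          using fold_squares[OF ei] by (intro gclass_in_N w) (simp_all add: st fold_letter_pos_word)
        moreover have "H (gclass ?w) = frag_of i"
        proof (rule poly_mapping_eqI)
          fix j
          have "e j = e i \<longleftrightarrow> j = i" if "j < ?n"
            using i that bij_betw_imp_inj_on[OF e] by (auto dest: inj_onD)
          then show "poly_mapping.lookup (H (gclass ?w)) j = poly_mapping.lookup (frag_of i) j"
            using i by (simp add: lookup_H class_stot_gclass[OF w e_in] st)
        qed
        ultimately show "frag_of i \<in> H ` carrier N"
          by (metis imageI)
      qed
    qed
  qed (use H_carrier in blast)
  ultimately have "H \<in> iso N ?F"
    using H.homh by (simp add: iso_def bij_betw_def)
  then show ?thesis
    by (rule is_isoI)
qed

end

theorem mainTheorem1:
  fixes X :: "'a set" and S :: "'a \<times> 'a \<Rightarrow> 'a \<times> 'a" and n :: nat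
  assumes "finite X" and "card X = n"
    and "nondegenerate X S" and "symmetric_sol X S"
  shows
    "(group (struct_group X S) \<and> group (GL X)
        \<and> psi X S \<in> hom (struct_group X S) (GL X)
        \<and> (\<forall>x\<in>X. psi X S (struct_gen X S x) = psi_gen X S x)
        \<and> psi X S \<in> epi (struct_group X S) (W_group X S)
        \<and> finite (carrier (W_group X S))
        \<and> generating_generated_group (W_group X S) (psi_gen X S ` X) (struct_monoid X S))
     \<and>
     (property_C X S \<longrightarrow>
        generating_generated_section (W_group X S) (psi_gen X S ` X) (struct_monoid X S)
        \<and> order (W_group X S) = 2 ^ n
        \<and> short_exact (N_group X S) (\<lambda>c. c) (struct_group X S) (psi X S) (W_group X S)
        \<and> N_group X S \<cong> free_Abelian_group {..<n})"
proof (intro conjI impI)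
  interpret sym_solution X S
    using assms by unfold_locales
  show "group (struct_group X S)" "group (GL X)" "psi X S \<in> hom (struct_group X S) (GL X)"
    "\<forall>x\<in>X. psi X S (struct_gen X S x) = psi_gen X S x"
    "psi X S \<in> epi (struct_group X S) (W_group X S)" "finite (carrier (W_group X S))"
    "generating_generated_group (W_group X S) (psi_gen X S ` X) (struct_monoid X S)"
    using group_G group_GL psi_hom psi_struct_gen psi_epi finite_W generating_generated by simp_all
next
  assume "property_C X S"
  then interpret sym_solution_C X S
    using assms by unfold_locales
  show "generating_generated_section (W_group X S) (psi_gen X S ` X) (struct_monoid X S)"
    "order (W_group X S) = 2 ^ n"
    "short_exact (N_group X S) (\<lambda>c. c) (struct_group X S) (psi X S) (W_group X S)"
    "N_group X S \<cong> free_Abelian_group {..<n}"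
    using generating_section order_W short_exact_N N_iso_free_Abelian assms(2) by simp_all
qed

end
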